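(* For every data language $L\subseteq(\Sigma\times D)^*$, there is a session automaton $\mathcal A$ with $L(\mathcal A)=L$ if and only if there is an sMSO sentence $\phi$ with $L(\phi)=L$.
   Context: $\Sigma$ is a non-empty finite alphabet, $D$ an infinite set of data values; data words are elements of $(\Sigma\times D)^*$. Data words $(a_1,d_1)\cdots(a_n,d_n)$, $(a_1',d_1')\cdots(a_m',d_m')$ are equivalent if $n=m$, $a_i=a_i'$ and ($d_i=d_j\iff d_i'=d_j'$) for all $i,j$; a data language is a set of data words closed under this equivalence. A session automaton $(S,\mathcal R,\iota,F,\Delta)$ has finite non-empty state set $S$, finite non-empty register set $\mathcal R$, initial state $\iota$, final states $F$, and finitely many transitions $(s,(a,\pi),s')$ with $a\in\Sigma$, $\pi\in\{r^\circledast,r^\uparrow:r\in\mathcal R\}$; configurations $(s,\tau,U)$ with $\tau:\mathcal R\rightharpoonup D$ partial, $U\subseteq D$; reading $(a,d)$ on register $r$ requires $d=\tau(r)$ for $r^\uparrow$ and $d\notin U$ for $r^\circledast$, then sets $\tau(r):=d$, $U:=U\cup\{d\}$; runs start in $(\iota,\emptyset,\emptyset)$ and $L(\mathcal A)$ is the set of data words with a run ending in $F$. dMSO formulas: $\phi::=\mathrm{label}(x)=a\mid x=y\mid y=x+1\mid x\sim y\mid x\in X\mid\neg\phi\mid\phi\lor\phi\mid\exists x\,\phi\mid\exists X\,\phi$, interpreted over a data word $(a_1,d_1)\cdots(a_n,d_n)$ with first-order variables ranging over positions, second-order variables over sets of positions; $\mathrm{label}(x)=a$ means $a_x=a$, $y=x+1$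 is successor, $x\sim y$ means $d_x=d_y$. A classical MSO formula is a dMSO formula not containing $\sim$. An sMSO sentence is a dMSO sentence of the form $\exists X_1\cdots\exists X_m\,(\alpha\wedge\forall x\forall y\,(x\sim y\leftrightarrow\beta))$ where $\alpha,\beta$ are classical MSO formulas. $L(\phi)$ is the set of data words satisfying $\phi$. *)

theory Defs
  imports Main
begin

text \<open>The alphabet is a type of class \<open>finite\<close> (types are non-empty), the
  data values are the elements of a type \<open>'d\<close>; that \<open>'d\<close> is infinite is an
  explicit hypothesis of the theorem. Positions are numbered from 0.\<close>

type_synonym ('a, 'd) data_word = "('a \<times> 'd) list"

definition data_equiv :: "('a, 'd) data_word \<Rightarrow> ('a, 'd) data_word \<Rightarrow> bool" where
  "data_equiv u v \<longleftrightarrow>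
     length u = length v \<and>
     (\<forall>i<length u. fst (u ! i) = fst (v ! i)) \<and>
     (\<forall>i<length u. \<forall>j<length u. snd (u ! i) = snd (u ! j) \<longleftrightarrow> snd (v ! i) = snd (v ! j))"

definition data_language :: "('a, 'd) data_word set \<Rightarrow> bool" where
  "data_language L \<longleftrightarrow> (\<forall>u v. u \<in> L \<longrightarrow> data_equiv u v \<longrightarrow> v \<in> L)"


subsection \<open>Session automata\<close>

text \<open>\<open>Fresh r\<close> is $r^\circledast$, \<open>Reuse r\<close> is $r^\uparrow$.\<close>

datatype 'r reg_op = Fresh 'r | Reuse 'r

primrec op_reg :: "'r reg_op \<Rightarrow> 'r" where
  "op_reg (Fresh r) = r"
| "op_reg (Reuse r) = r"

text \<open>Existence of an automaton is stated with states and registers drawn from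
  \<open>nat\<close>; as both sets are finite, this loses no automaton up to renaming.\<close>

record ('s, 'r, 'a) session_automaton =
  sa_states :: "'s set"
  sa_regs :: "'r set"
  sa_init :: 's
  sa_final :: "'s set"
  sa_trans :: "('s \<times> ('a \<times> 'r reg_op) \<times> 's) set"

definition session_automaton :: "('s, 'r, 'a) session_automaton \<Rightarrow> bool" where
  "session_automaton A \<longleftrightarrow>
     finite (sa_states A) \<and> sa_states A \<noteq> {} \<and>
     finite (sa_regs A) \<and> sa_regs A \<noteq> {} \<and>
     sa_init A \<in> sa_states A \<and>
     sa_final A \<subseteq> sa_states A \<and>
     finite (sa_trans A) \<and>
     (\<forall>(s, (a, p), s') \<in> sa_trans A.
        s \<in> sa_states A \<and> op_reg p \<in> sa_regs A \<and> s' \<in> sa_states A)"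

type_synonym ('s, 'r, 'd) config = "'s \<times> ('r \<rightharpoonup> 'd) \<times> 'd set"

inductive sa_step ::
  "('s, 'r, 'a) session_automaton \<Rightarrow> ('s, 'r, 'd) config \<Rightarrow> 'a \<times> 'd \<Rightarrow> ('s, 'r, 'd) config \<Rightarrow> bool"
  for A where
  fresh: "(s, (a, Fresh r), s') \<in> sa_trans A \<Longrightarrow> d \<notin> U \<Longrightarrow>
            sa_step A (s, \<tau>, U) (a, d) (s', \<tau>(r \<mapsto> d), U \<union> {d})"
| reuse: "(s, (a, Reuse r), s') \<in> sa_trans A \<Longrightarrow> \<tau> r = Some d \<Longrightarrow>
            sa_step A (s, \<tau>, U) (a, d) (s', \<tau>(r \<mapsto> d), U \<union> {d})"

inductive sa_run ::
  "('s, 'r, 'a) session_automaton \<Rightarrow> ('s, 'r, 'd) config \<Rightarrow> ('a, 'd) data_word \<Rightarrow> ('s, 'r, 'd) config \<Rightarrow> bool"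
  for A where
  Nil: "sa_run A c [] c"
| Cons: "sa_step A c x c' \<Longrightarrow> sa_run A c' w c'' \<Longrightarrow> sa_run A c (x # w) c''"

definition sa_lang :: "('s, 'r, 'a) session_automaton \<Rightarrow> ('a, 'd) data_word set" where
  "sa_lang A = {w. \<exists>s \<tau> U. s \<in> sa_final A \<and> sa_run A (sa_init A, Map.empty, {}) w (s, \<tau>, U)}"


subsection \<open>Data MSO\<close>

text \<open>First-order and second-order variables are two separate copies of \<open>nat\<close>.
  \<open>Succ x y\<close> stands for $y = x + 1$.\<close>

datatype 'a dmso =
    Label nat 'a
  | Eq nat nat
  | Succ nat nat
  | Sim nat nat
  | Mem nat nat
  | Neg "'a dmso"
  | Or "'a dmso" "'a dmso"
  | Ex1 nat "'a dmso"
  | Ex2 nat "'a dmso"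

definition And :: "'a dmso \<Rightarrow> 'a dmso \<Rightarrow> 'a dmso" where
  "And \<phi> \<psi> = Neg (Or (Neg \<phi>) (Neg \<psi>))"

definition Iff :: "'a dmso \<Rightarrow> 'a dmso \<Rightarrow> 'a dmso" where
  "Iff \<phi> \<psi> = And (Or (Neg \<phi>) \<psi>) (Or (Neg \<psi>) \<phi>)"

definition All1 :: "nat \<Rightarrow> 'a dmso \<Rightarrow> 'a dmso" where
  "All1 x \<phi> = Neg (Ex1 x (Neg \<phi>))"

primrec sat ::
  "('a, 'd) data_word \<Rightarrow> (nat \<Rightarrow> nat) \<Rightarrow> (nat \<Rightarrow> nat set) \<Rightarrow> 'a dmso \<Rightarrow> bool" where
  "sat w v V (Label x a) \<longleftrightarrow> fst (w ! v x) = a"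
| "sat w v V (Eq x y) \<longleftrightarrow> v x = v y"
| "sat w v V (Succ x y) \<longleftrightarrow> v y = v x + 1"
| "sat w v V (Sim x y) \<longleftrightarrow> snd (w ! v x) = snd (w ! v y)"
| "sat w v V (Mem x X) \<longleftrightarrow> v x \<in> V X"
| "sat w v V (Neg \<phi>) \<longleftrightarrow> \<not> sat w v V \<phi>"
| "sat w v V (Or \<phi> \<psi>) \<longleftrightarrow> sat w v V \<phi> \<or> sat w v V \<psi>"
| "sat w v V (Ex1 x \<phi>) \<longleftrightarrow> (\<exists>i<length w. sat w (v(x := i)) V \<phi>)"
| "sat w v V (Ex2 X \<phi>) \<longleftrightarrow> (\<exists>P\<subseteq>{..<length w}. sat w v (V(X := P)) \<phi>)"

primrec fv1 :: "'a dmso \<Rightarrow> nat set" where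
  "fv1 (Label x a) = {x}"
| "fv1 (Eq x y) = {x, y}"
| "fv1 (Succ x y) = {x, y}"
| "fv1 (Sim x y) = {x, y}"
| "fv1 (Mem x X) = {x}"
| "fv1 (Neg \<phi>) = fv1 \<phi>"
| "fv1 (Or \<phi> \<psi>) = fv1 \<phi> \<union> fv1 \<psi>"
| "fv1 (Ex1 x \<phi>) = fv1 \<phi> - {x}"
| "fv1 (Ex2 X \<phi>) = fv1 \<phi>"

primrec fv2 :: "'a dmso \<Rightarrow> nat set" where
  "fv2 (Label x a) = {}"
| "fv2 (Eq x y) = {}"
| "fv2 (Succ x y) = {}"
| "fv2 (Sim x y) = {}"
| "fv2 (Mem x X) = {X}"
| "fv2 (Neg \<phi>) = fv2 \<phi>"
| "fv2 (Or \<phi> \<psi>) = fv2 \<phi> \<union> fv2 \<psi>"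
| "fv2 (Ex1 x \<phi>) = fv2 \<phi>"
| "fv2 (Ex2 X \<phi>) = fv2 \<phi> - {X}"

definition sentence :: "'a dmso \<Rightarrow> bool" where
  "sentence \<phi> \<longleftrightarrow> fv1 \<phi> = {} \<and> fv2 \<phi> = {}"

primrec classical_mso :: "'a dmso \<Rightarrow> bool" where
  "classical_mso (Label x a) \<longleftrightarrow> True"
| "classical_mso (Eq x y) \<longleftrightarrow> True"
| "classical_mso (Succ x y) \<longleftrightarrow> True"
| "classical_mso (Sim x y) \<longleftrightarrow> False"
| "classical_mso (Mem x X) \<longleftrightarrow> True"
| "classical_mso (Neg \<phi>) \<longleftrightarrow> classical_mso \<phi>"
| "classical_mso (Or \<phi> \<psi>) \<longleftrightarrow> classical_mso \<phi> \<and> classical_mso \<psi>"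
| "classical_mso (Ex1 x \<phi>) \<longleftrightarrow> classical_mso \<phi>"
| "classical_mso (Ex2 X \<phi>) \<longleftrightarrow> classical_mso \<phi>"

text \<open>The variables \<open>x\<close> and \<open>y\<close> must be distinct: for \<open>x = y\<close> the matrix would
  say nothing about the data values. The list \<open>Xs\<close> may be empty.\<close>

definition smso_sentence :: "'a dmso \<Rightarrow> bool" where
  "smso_sentence \<phi> \<longleftrightarrow>
     sentence \<phi> \<and>
     (\<exists>Xs \<alpha> x y \<beta>. x \<noteq> y \<and> classical_mso \<alpha> \<and> classical_mso \<beta> \<and>
        \<phi> = foldr Ex2 Xs (And \<alpha> (All1 x (All1 y (Iff (Sim x y) \<beta>)))))"

text \<open>Used for sentences only, whose truth does not depend on the valuations;
  the ones below are arbitrary.\<close>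

definition dmso_lang :: "'a dmso \<Rightarrow> ('a, 'd) data_word set" where
  "dmso_lang \<phi> = {w. sat w (\<lambda>_. 0) (\<lambda>_. {}) \<phi>}"

end

theory Submission imports Defs begin

text \<open>A word over the register operations splits its positions into sessions: maximal runs of uses
  of one register that are not separated by a \<open>Fresh\<close> on that register. A data word can be read with
  a given sequence of operations iff every register is first used by \<open>Fresh\<close> and equality of data
  values coincides with the session relation, which is definable in classical MSO. Hence an sMSO
  sentence can guess the transitions of a run, check with \<open>\<alpha>\<close> that they form a run, and take the
  session relation for \<open>\<beta>\<close>.

  Conversely, \<open>\<beta>\<close> has finitely many residuals, so only boundedly many data values can occur on both
  sides of a cut of a model, and a bounded number of registers suffices to realise \<open>\<sim>\<close> as a
  session relation. That the guessed sets satisfy \<open>\<alpha>\<close> and that the guessed register operations have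
  session relation \<open>\<beta>\<close> is a classical MSO property, and its residuals are the states of the session
  automaton.\<close>

section \<open>Formulas\<close>

lemma sat_And [simp]: "sat w v V (And \<phi> \<psi>) \<longleftrightarrow> sat w v V \<phi> \<and> sat w v V \<psi>"
  by (simp add: And_def)

lemma sat_Iff [simp]: "sat w v V (Iff \<phi> \<psi>) \<longleftrightarrow> (sat w v V \<phi> \<longleftrightarrow> sat w v V \<psi>)"
  by (auto simp: Iff_def)

lemma sat_All1 [simp]: "sat w v V (All1 x \<phi>) \<longleftrightarrow> (\<forall>i<length w. sat w (v(x := i)) V \<phi>)"
  by (simp add: All1_def)

lemma fv1_derived [simp]:
  "fv1 (And \<phi> \<psi>) = fv1 \<phi> \<union> fv1 \<psi>" "fv1 (Iff \<phi> \<psi>) = fv1 \<phi> \<union> fv1 \<psi>"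
  "fv1 (All1 x \<phi>) = fv1 \<phi> - {x}"
  by (auto simp: And_def Iff_def All1_def)

lemma fv2_derived [simp]:
  "fv2 (And \<phi> \<psi>) = fv2 \<phi> \<union> fv2 \<psi>" "fv2 (Iff \<phi> \<psi>) = fv2 \<phi> \<union> fv2 \<psi>"
  "fv2 (All1 x \<phi>) = fv2 \<phi>"
  by (auto simp: And_def Iff_def All1_def)

lemma classical_mso_derived [simp]:
  "classical_mso (And \<phi> \<psi>) \<longleftrightarrow> classical_mso \<phi> \<and> classical_mso \<psi>"
  "classical_mso (Iff \<phi> \<psi>) \<longleftrightarrow> classical_mso \<phi> \<and> classical_mso \<psi>"
  "classical_mso (All1 x \<phi>) \<longleftrightarrow> classical_mso \<phi>"
  by (auto simp: And_def Iff_def All1_def)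

lemma sat_cong:
  assumes "\<And>x. x \<in> fv1 \<phi> \<Longrightarrow> v x = v' x" "\<And>X. X \<in> fv2 \<phi> \<Longrightarrow> V X = V' X"
  shows "sat w v V \<phi> \<longleftrightarrow> sat w v' V' \<phi>"
  using assms
proof (induction \<phi> arbitrary: v v' V V')
  case (Or \<phi> \<psi>)
  have "sat w v V \<phi> \<longleftrightarrow> sat w v' V' \<phi>" "sat w v V \<psi> \<longleftrightarrow> sat w v' V' \<psi>"
    by (rule Or.IH; simp add: Or.prems)+
  then show ?case by simp
next
  case (Ex1 x \<phi>)
  have "sat w (v(x := i)) V \<phi> \<longleftrightarrow> sat w (v'(x := i)) V' \<phi>" for i
    by (rule Ex1.IH) (simp_all add: Ex1.prems)
  then show ?case by simp
next
  case (Ex2 X \<phi>)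
  have "sat w v (V(X := P)) \<phi> \<longleftrightarrow> sat w v' (V'(X := P)) \<phi>" for P
    by (rule Ex2.IH) (simp_all add: Ex2.prems)
  then show ?case by simp
next
  case (Neg \<phi>)
  have "sat w v V \<phi> \<longleftrightarrow> sat w v' V' \<phi>"
    by (rule Neg.IH) (simp_all add: Neg.prems)
  then show ?case by simp
qed simp_all

text \<open>A block of set quantifiers amounts to one choice of a valuation that agrees with
  \<open>V\<close> off the block. Repetitions in \<open>Xs\<close> are harmless: the inner
  quantifier overrides the outer one.\<close>

lemma sat_foldr_Ex2:
  "sat w v V (foldr Ex2 Xs \<psi>) \<longleftrightarrow>
     (\<exists>V'. (\<forall>X\<in>set Xs. V' X \<subseteq> {..<length w}) \<and> (\<forall>X. X \<notin> set Xs \<longrightarrow> V' X = V X) \<and> sat w v V' \<psi>)"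
proof (induction Xs arbitrary: V)
  case Nil
  have "(\<forall>X. V' X = V X) \<longleftrightarrow> V' = V" for V' by auto
  then show ?case by simp
next
  case (Cons X Xs)
  show ?case
  proof
    assume "sat w v V (foldr Ex2 (X # Xs) \<psi>)"
    then obtain P V' where "P \<subseteq> {..<length w}" "\<forall>X\<in>set Xs. V' X \<subseteq> {..<length w}"
      "\<forall>Y. Y \<notin> set Xs \<longrightarrow> V' Y = (V(X := P)) Y" "sat w v V' \<psi>"
      using Cons.IH by auto
    then show "\<exists>V'. (\<forall>Y\<in>set (X # Xs). V' Y \<subseteq> {..<length w}) \<and>
      (\<forall>Y. Y \<notin> set (X # Xs) \<longrightarrow> V' Y = V Y) \<and> sat w v V' \<psi>"
      \<comment> \<open>If \<open>X\<close> is bound again further inside, \<open>P\<close> has been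
        overwritten; otherwise \<open>V' X = P\<close>.\<close>
      by (intro exI[of _ V']) (cases "X \<in> set Xs"; auto split: if_splits)
  next
    assume "\<exists>V'. (\<forall>Y\<in>set (X # Xs). V' Y \<subseteq> {..<length w}) \<and>
      (\<forall>Y. Y \<notin> set (X # Xs) \<longrightarrow> V' Y = V Y) \<and> sat w v V' \<psi>"
    then obtain V' where "\<forall>Y\<in>set (X # Xs). V' Y \<subseteq> {..<length w}"
      "\<forall>Y. Y \<notin> set (X # Xs) \<longrightarrow> V' Y = V Y" "sat w v V' \<psi>" by blast
    then have "sat w v (V(X := V' X)) (foldr Ex2 Xs \<psi>)" "V' X \<subseteq> {..<length w}"
      unfolding Cons.IH by auto
    then show "sat w v V (foldr Ex2 (X # Xs) \<psi>)" by auto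
  qed
qed

lemma fv_foldr_Ex2:
  "fv1 (foldr Ex2 Xs \<psi>) = fv1 \<psi>" "fv2 (foldr Ex2 Xs \<psi>) = fv2 \<psi> - set Xs"
  by (induction Xs) auto

section \<open>Regularity of classical MSO\<close>

definition residual :: "('b list \<Rightarrow> bool) \<Rightarrow> 'b list \<Rightarrow> 'b list set" where
  "residual P u = {v. P (u @ v)}"

text \<open>The Myhill-Nerode criterion serves as the definition: it makes sense over infinite
  alphabets, and the letters used below contain arbitrary sets of variables.\<close>

definition regular :: "('b list \<Rightarrow> bool) \<Rightarrow> bool" where
  "regular P \<longleftrightarrow> finite (range (residual P))"

text \<open>If the residual at \<open>u\<close> depends only on \<open>h u\<close>, there are at
  most as many residuals as values of \<open>h\<close>. Each closure proof below exhibits such a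
  finite summary \<open>h\<close> of the prefix.\<close>

lemma regular_if_factors:
  assumes fin: "finite (range h)"
    and fact: "\<And>u u'. h u = h u' \<Longrightarrow> residual P u = residual P u'"
  shows "regular P"
proof -
  have "residual P u = residual P (SOME u'. h u' = h u)" for u
    by (rule fact) (metis (mono_tags) someI)
  then have "range (residual P) \<subseteq> (\<lambda>c. residual P (SOME u'. h u' = c)) ` range h"
    by auto
  then show ?thesis
    unfolding regular_def using fin finite_surj by blast
qed

lemma regular_not: "regular P \<Longrightarrow> regular (\<lambda>e. \<not> P e)"
  by (rule regular_if_factors[of "residual P"]) (auto simp: regular_def residual_def)

lemma regular_or:
  assumes "regular P" "regular Q"
  shows "regular (\<lambda>e. P e \<or> Q e)"
proof (rule regular_if_factors[of "\<lambda>u. (residual P u, residual Q u)"])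
  have "range (\<lambda>u. (residual P u, residual Q u)) \<subseteq> range (residual P) \<times> range (residual Q)"
    by auto
  then show "finite (range (\<lambda>u. (residual P u, residual Q u)))"
    using assms by (meson finite_SigmaI finite_subset regular_def)
qed (auto simp: residual_def)

lemma regular_and:
  assumes "regular P" "regular Q"
  shows "regular (\<lambda>e. P e \<and> Q e)"
proof -
  have "regular (\<lambda>e. \<not> (\<not> P e \<or> \<not> Q e))"
    by (intro regular_not regular_or assms)
  then show ?thesis by simp
qed

text \<open>The subset construction: the residual of the projection at \<open>u\<close> is determined by the set of
  residuals of \<open>P\<close> at the preimages of \<open>u\<close>.\<close>

lemma regular_projection:
  assumes "regular P"
  shows "regular (\<lambda>e. \<exists>e'. list_all2 R e e' \<and> P e')"
proof (rule regular_if_factors[of "\<lambda>u. residual P ` {u'. list_all2 R u u'}"])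
  have "range (\<lambda>u. residual P ` {u'. list_all2 R u u'}) \<subseteq> Pow (range (residual P))"
    by auto
  then show "finite (range (\<lambda>u. residual P ` {u'. list_all2 R u u'}))"
    using assms by (meson finite_Pow_iff finite_subset regular_def)
next
  have eq: "residual (\<lambda>e. \<exists>e'. list_all2 R e e' \<and> P e') u =
      {v. \<exists>v'. list_all2 R v v' \<and> (\<exists>D \<in> residual P ` {u'. list_all2 R u u'}. v' \<in> D)}" for u
  proof (intro set_eqI iffI)
    fix v assume "v \<in> residual (\<lambda>e. \<exists>e'. list_all2 R e e' \<and> P e') u"
    then obtain u' v' where "list_all2 R u u'" "list_all2 R v v'" "P (u' @ v')"
      by (auto simp: residual_def list_all2_append1)
    then show "v \<in> {v. \<exists>v'. list_all2 R v v' \<and>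
        (\<exists>D \<in> residual P ` {u'. list_all2 R u u'}. v' \<in> D)}"
      by (auto simp: residual_def)
  next
    fix v assume "v \<in> {v. \<exists>v'. list_all2 R v v' \<and>
        (\<exists>D \<in> residual P ` {u'. list_all2 R u u'}. v' \<in> D)}"
    then obtain u' v' where "list_all2 R u u'" "list_all2 R v v'" "P (u' @ v')"
      by (auto simp: residual_def)
    then show "v \<in> residual (\<lambda>e. \<exists>e'. list_all2 R e e' \<and> P e') u"
      unfolding residual_def using list_all2_appendI by blast
  qed
  fix u u' assume "residual P ` {x. list_all2 R u x} = residual P ` {x. list_all2 R u' x}"
  then show "residual (\<lambda>e. \<exists>e'. list_all2 R e e' \<and> P e') u =
      residual (\<lambda>e. \<exists>e'. list_all2 R e e' \<and> P e') u'"
    unfolding eq by simp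
qed

text \<open>The residual at \<open>u\<close> is the preimage under \<open>map g\<close> of the
  residual of \<open>P\<close> at \<open>map g u\<close>.\<close>

lemma regular_map: "regular P \<Longrightarrow> regular (\<lambda>e. P (map g e))"
  by (rule regular_if_factors[of "\<lambda>u. residual P (map g u)"])
    (auto simp: regular_def residual_def elim: finite_subset[rotated])

lemma regular_ex_letter: "regular (\<lambda>e. \<exists>l\<in>set e. Q l)"
  by (rule regular_if_factors[of "\<lambda>u. \<exists>l\<in>set u. Q l"]) (auto simp: residual_def)

text \<open>Counting may stop at 2, since from there on no continuation can bring the count back to
  1.\<close>

lemma regular_one_letter: "regular (\<lambda>e. length (filter Q e) = 1)"
proof (rule regular_if_factors[of "\<lambda>u. min 2 (length (filter Q u))"])
  have "range (\<lambda>u. min 2 (length (filter Q u))) \<subseteq> {..2}" by auto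
  then show "finite (range (\<lambda>u. min 2 (length (filter Q u))))"
    using finite_subset by blast
qed (auto simp: residual_def min_def split: if_splits)

text \<open>The summary of a prefix records whether a matching pair has occurred and whether the
  last letter can start one.\<close>

lemma regular_adjacent:
  "regular (\<lambda>e. \<exists>i. Suc i < length e \<and> P (e ! i) \<and> Q (e ! Suc i))" (is "regular ?A")
proof (rule regular_if_factors[of "\<lambda>u. (?A u, u \<noteq> [] \<and> P (last u))"])
  \<comment> \<open>A matching pair lies within \<open>u\<close>, straddles the cut, or lies within
    \<open>v\<close>.\<close>
  have split: "?A (u @ v) \<longleftrightarrow> ?A u \<or> (u \<noteq> [] \<and> P (last u)) \<and> v \<noteq> [] \<and> Q (hd v) \<or> ?A v" for u v
  proof
    assume "?A (u @ v)"
    then obtain i where i: "Suc i < length (u @ v)" "P ((u @ v) ! i)" "Q ((u @ v) ! Suc i)"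
      by blast
    consider "Suc i < length u" | "Suc i = length u" | "i \<ge> length u" by linarith
    then show "?A u \<or> (u \<noteq> [] \<and> P (last u)) \<and> v \<noteq> [] \<and> Q (hd v) \<or> ?A v"
    proof cases
      case 1
      then show ?thesis using i by (auto simp: nth_append)
    next
      case 2
      then have "i = length u - 1" by simp
      then show ?thesis using i 2
        by (cases "u = []"; cases "v = []") (auto simp: nth_append last_conv_nth hd_conv_nth)
    next
      case 3
      then have "Suc (i - length u) < length v" "P (v ! (i - length u))" "Q (v ! Suc (i - length u))"
        using i by (auto simp: nth_append Suc_diff_le)
      then show ?thesis by blast
    qed
  next
    assume "?A u \<or> (u \<noteq> [] \<and> P (last u)) \<and> v \<noteq> [] \<and> Q (hd v) \<or> ?A v"
    then consider i where "Suc i < length u" "P (u ! i)" "Q (u ! Suc i)"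
      | "u \<noteq> []" "P (last u)" "v \<noteq> []" "Q (hd v)"
      | i where "Suc i < length v" "P (v ! i)" "Q (v ! Suc i)" by blast
    then show "?A (u @ v)"
    proof cases
      case 1
      then show ?thesis by (intro exI[of _ i]) (auto simp: nth_append)
    next
      case 2
      then show ?thesis
        by (intro exI[of _ "length u - 1"]) (auto simp: nth_append last_conv_nth hd_conv_nth)
    next
      case 3
      then show ?thesis by (intro exI[of _ "length u + i"]) (auto simp: nth_append)
    qed
  qed
  show "finite (range (\<lambda>u. (?A u, u \<noteq> [] \<and> P (last u))))"
    by (rule finite_subset[of _ "UNIV \<times> UNIV"]) auto
  fix u u' assume "(?A u, u \<noteq> [] \<and> P (last u)) = (?A u', u' \<noteq> [] \<and> P (last u'))"
  then have "?A u = ?A u'" "(u \<noteq> [] \<and> P (last u)) = (u' \<noteq> [] \<and> P (last u'))"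
    by auto
  then show "residual ?A u = residual ?A u'"
    unfolding residual_def split by simp
qed

section \<open>Classical MSO over annotated words\<close>

text \<open>A letter carries its label, the first-order variables placed at its position, and the
  second-order variables whose value contains its position.\<close>

type_synonym 'a letter = "'a \<times> nat set \<times> nat set"

abbreviation fo :: "'a letter \<Rightarrow> nat set" where "fo l \<equiv> fst (snd l)"
abbreviation so :: "'a letter \<Rightarrow> nat set" where "so l \<equiv> snd (snd l)"

text \<open>Quantifying over a variable means forgetting its track, a projection in the sense of
  \<open>regular_projection\<close>; this relation and \<open>eq_off2\<close> give it letter by
  letter.\<close>

definition eq_off1 :: "nat \<Rightarrow> 'a letter \<Rightarrow> 'a letter \<Rightarrow> bool" where
  "eq_off1 x l l' \<longleftrightarrow> fst l = fst l' \<and> fo l - {x} = fo l' - {x} \<and> so l = so l'"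

definition eq_off2 :: "nat \<Rightarrow> 'a letter \<Rightarrow> 'a letter \<Rightarrow> bool" where
  "eq_off2 X l l' \<longleftrightarrow> fst l = fst l' \<and> fo l = fo l' \<and> so l - {X} = so l' - {X}"

text \<open>This semantics covers all annotated words, including those where a first-order variable
  marks no position or several. Hence atoms ask for some suitable letter, and \<open>Ex1\<close> has
  to demand uniqueness. Letters carry no data values, so \<open>Sim\<close> gets a dummy
  value.\<close>

primrec wsat :: "'a letter list \<Rightarrow> 'a dmso \<Rightarrow> bool" where
  "wsat e (Label x a) \<longleftrightarrow> (\<exists>l\<in>set e. fst l = a \<and> x \<in> fo l)"
| "wsat e (Eq x y) \<longleftrightarrow> (\<exists>l\<in>set e. x \<in> fo l \<and> y \<in> fo l)"
| "wsat e (Succ x y) \<longleftrightarrow> (\<exists>i. Suc i < length e \<and> x \<in> fo (e ! i) \<and> y \<in> fo (e ! Suc i))"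
| "wsat e (Sim x y) \<longleftrightarrow> False"
| "wsat e (Mem x X) \<longleftrightarrow> (\<exists>l\<in>set e. x \<in> fo l \<and> X \<in> so l)"
| "wsat e (Neg \<phi>) \<longleftrightarrow> \<not> wsat e \<phi>"
| "wsat e (Or \<phi> \<psi>) \<longleftrightarrow> wsat e \<phi> \<or> wsat e \<psi>"
| "wsat e (Ex1 x \<phi>) \<longleftrightarrow>
     (\<exists>e'. list_all2 (eq_off1 x) e e' \<and> (length (filter (\<lambda>l. x \<in> fo l) e') = 1 \<and> wsat e' \<phi>))"
| "wsat e (Ex2 X \<phi>) \<longleftrightarrow> (\<exists>e'. list_all2 (eq_off2 X) e e' \<and> wsat e' \<phi>)"

text \<open>This is the direction of Buechi's theorem from logic to recognisability: every clause of
  \<open>wsat\<close> has the shape of one of the closure properties above.\<close>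

lemma regular_wsat: "regular (\<lambda>e. wsat e \<phi>)"
proof (induction \<phi>)
  case (Sim x y)
  show ?case by (simp add: regular_def residual_def)
next
  case (Ex1 x \<phi>)
  show ?case unfolding wsat.simps
    by (intro regular_projection regular_and regular_one_letter Ex1.IH)
qed (unfold wsat.simps; intro regular_ex_letter regular_adjacent regular_not regular_or
      regular_projection; assumption)+

text \<open>A variable whose value is \<open>length w\<close> or more leaves no mark; later,
  \<open>length w\<close> is used as the value of unplaced variables.\<close>

definition enc :: "('a, 'd) data_word \<Rightarrow> (nat \<Rightarrow> nat) \<Rightarrow> (nat \<Rightarrow> nat set) \<Rightarrow> 'a letter list" where
  "enc w v V = map (\<lambda>i. (fst (w ! i), {x. v x = i}, {X. i \<in> V X})) [0..<length w]"

lemma length_enc [simp]: "length (enc w v V) = length w"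
  by (simp add: enc_def)

lemma enc_nth [simp]:
  "i < length w \<Longrightarrow> enc w v V ! i = (fst (w ! i), {x. v x = i}, {X. i \<in> V X})"
  by (simp add: enc_def)

lemma bex_enc:
  "(\<exists>l\<in>set (enc w v V). Q l) \<longleftrightarrow> (\<exists>i<length w. Q (fst (w ! i), {x. v x = i}, {X. i \<in> V X}))"
  by (auto simp: enc_def)

text \<open>The free first-order variables must lie inside the word: \<open>Eq x x\<close> holds
  under every valuation, but \<open>wsat\<close> needs a letter marked with
  \<open>x\<close>.\<close>

lemma wsat_enc:
  assumes "classical_mso \<phi>" "\<And>x. x \<in> fv1 \<phi> \<Longrightarrow> v x < length w"
  shows "wsat (enc w v V) \<phi> \<longleftrightarrow> sat w v V \<phi>"
  using assms
proof (induction \<phi> arbitrary: v V)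
  case (Ex1 x \<phi>)
  have IH: "wsat (enc w (v(x := i)) V) \<phi> \<longleftrightarrow> sat w (v(x := i)) V \<phi>" if "i < length w" for i
    using that Ex1.prems by (intro Ex1.IH) auto
  show ?case
  proof
    assume "wsat (enc w v V) (Ex1 x \<phi>)"
    then obtain e' where e': "list_all2 (eq_off1 x) (enc w v V) e'"
      "length (filter (\<lambda>l. x \<in> fo l) e') = 1" "wsat e' \<phi>" by auto
    have len: "length e' = length w" using list_all2_lengthD[OF e'(1)] by simp
    from e'(2) obtain i where i: "{i. i < length e' \<and> x \<in> fo (e' ! i)} = {i}"
      unfolding length_filter_conv_card by (auto simp: card_1_singleton_iff)
    \<comment> \<open>\<open>e'\<close> may differ from the encoding only in the track of
      \<open>x\<close>, and that track marks exactly \<open>i\<close>.\<close>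
    have "e' = enc w (v(x := i)) V"
    proof (rule nth_equalityI)
      fix j assume j: "j < length e'"
      then have off: "eq_off1 x (enc w v V ! j) (e' ! j)"
        using list_all2_nthD2[OF e'(1)] by blast
      have "x \<in> fo (e' ! j) \<longleftrightarrow> j = i" using i j by blast
      with off j len show "e' ! j = enc w (v(x := i)) V ! j"
        by (cases "e' ! j") (auto simp: eq_off1_def)
    qed (simp add: len)
    moreover have "i \<in> {i. i < length e' \<and> x \<in> fo (e' ! i)}" unfolding i by simp
    then have "i < length w" using len by simp
    ultimately show "sat w v V (Ex1 x \<phi>)" using e'(3) IH by auto
  next
    assume "sat w v V (Ex1 x \<phi>)"
    then obtain i where i: "i < length w" "sat w (v(x := i)) V \<phi>" by auto
    have "{j. j < length w \<and> x \<in> fo (enc w (v(x := i)) V ! j)} = {i}"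
      using i by auto
    then have "length (filter (\<lambda>l. x \<in> fo l) (enc w (v(x := i)) V)) = 1"
      unfolding length_filter_conv_card by simp
    moreover have "list_all2 (eq_off1 x) (enc w v V) (enc w (v(x := i)) V)"
      by (auto simp: list_all2_conv_all_nth eq_off1_def)
    ultimately show "wsat (enc w v V) (Ex1 x \<phi>)" using IH i by auto
  qed
next
  case (Ex2 X \<phi>)
  have IH: "wsat (enc w v (V(X := P))) \<phi> \<longleftrightarrow> sat w v (V(X := P)) \<phi>" for P
    using Ex2.prems by (intro Ex2.IH) auto
  show ?case
  proof
    assume "wsat (enc w v V) (Ex2 X \<phi>)"
    then obtain e' where e': "list_all2 (eq_off2 X) (enc w v V) e'" "wsat e' \<phi>" by auto
    have len: "length e' = length w" using list_all2_lengthD[OF e'(1)] by simp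
    \<comment> \<open>The quantified set is read off from the track of \<open>X\<close> in
      \<open>e'\<close>.\<close>
    define P where "P = {i. i < length w \<and> X \<in> so (e' ! i)}"
    have "e' = enc w v (V(X := P))"
    proof (rule nth_equalityI)
      fix j assume j: "j < length e'"
      then have "eq_off2 X (enc w v V ! j) (e' ! j)"
        using list_all2_nthD2[OF e'(1)] by blast
      with j len show "e' ! j = enc w v (V(X := P)) ! j"
        by (cases "e' ! j") (auto simp: eq_off2_def P_def)
    qed (simp add: len)
    moreover have "P \<subseteq> {..<length w}" by (auto simp: P_def)
    ultimately show "sat w v V (Ex2 X \<phi>)" using e'(2) IH by auto
  next
    assume "sat w v V (Ex2 X \<phi>)"
    then obtain P where "sat w v (V(X := P)) \<phi>" by auto
    moreover have "list_all2 (eq_off2 X) (enc w v V) (enc w v (V(X := P)))"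
      by (auto simp: list_all2_conv_all_nth eq_off2_def)
    ultimately show "wsat (enc w v V) (Ex2 X \<phi>)" using IH by auto
  qed
next
  case (Succ x y)
  then have "v x < length w" "v y < length w" by auto
  then show ?case by (auto intro!: exI[of _ "v x"])
next
  case (Label x a)
  then have "v x < length w" by simp
  then show ?case by (auto simp: bex_enc)
next
  case (Eq x y)
  then have "v x < length w" by simp
  then show ?case by (auto simp: bex_enc)
next
  case (Mem x X)
  then have "v x < length w" by simp
  then show ?case by (auto simp: bex_enc)
qed simp_all

section \<open>Runs and sessions\<close>

text \<open>The register contents before step \<open>n\<close> depend only on the operations
  \<open>p\<close> and data values \<open>d\<close>, not on the states or labels of a run. Both are
  total functions for convenience; \<open>tau_cong\<close> and \<open>legal_cong\<close> show that
  only the values below \<open>n\<close> count.\<close>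

primrec tau :: "(nat \<Rightarrow> 'r reg_op) \<Rightarrow> (nat \<Rightarrow> 'd) \<Rightarrow> nat \<Rightarrow> 'r \<rightharpoonup> 'd" where
  "tau p d 0 = Map.empty"
| "tau p d (Suc n) = (tau p d n)(op_reg (p n) \<mapsto> d n)"

definition enabled :: "(nat \<Rightarrow> 'r reg_op) \<Rightarrow> (nat \<Rightarrow> 'd) \<Rightarrow> nat \<Rightarrow> bool" where
  "enabled p d i \<longleftrightarrow>
     (case p i of Fresh r \<Rightarrow> d i \<notin> d ` {..<i} | Reuse r \<Rightarrow> tau p d i r = Some (d i))"

definition legal :: "(nat \<Rightarrow> 'r reg_op) \<Rightarrow> (nat \<Rightarrow> 'd) \<Rightarrow> nat \<Rightarrow> bool" where
  "legal p d n \<longleftrightarrow> (\<forall>i<n. enabled p d i)"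

lemma legal_0 [simp]: "legal p d 0"
  by (simp add: legal_def)

lemma legal_Suc [simp]: "legal p d (Suc n) \<longleftrightarrow> legal p d n \<and> enabled p d n"
  by (auto simp: legal_def less_Suc_eq)

lemma tau_cong:
  assumes "\<And>i. i < n \<Longrightarrow> p i = p' i" "\<And>i. i < n \<Longrightarrow> d i = d' i"
  shows "tau p d n = tau p' d' n"
  using assms by (induction n) simp_all

lemma legal_cong:
  assumes "\<And>i. i < n \<Longrightarrow> p i = p' i" "\<And>i. i < n \<Longrightarrow> d i = d' i"
  shows "legal p d n \<longleftrightarrow> legal p' d' n"
proof -
  have "enabled p d i \<longleftrightarrow> enabled p' d' i" if "i < n" for i
  proof -
    have "tau p d i = tau p' d' i" using assms that by (intro tau_cong) auto
    moreover have "d ` {..<i} = d' ` {..<i}" using assms that by (intro image_cong) auto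
    ultimately show ?thesis using assms[OF that] by (simp only: enabled_def)
  qed
  then show ?thesis by (simp add: legal_def)
qed

text \<open>Every operation writes its register, so a register holds the value of the latest
  position that used it.\<close>

lemma tau_eq_Some:
  "tau p d n r = Some a \<longleftrightarrow>
     (\<exists>j<n. op_reg (p j) = r \<and> d j = a \<and> (\<forall>z. j < z \<and> z < n \<longrightarrow> op_reg (p z) \<noteq> r))"
proof (induction n)
  case (Suc n)
  show ?case
  proof (cases "op_reg (p n) = r")
    case True
    then show ?thesis by (auto simp: less_Suc_eq)
  next
    case False
    then have "tau p d (Suc n) r = Some a \<longleftrightarrow> tau p d n r = Some a" by auto
    then show ?thesis using False unfolding Suc.IH by (auto simp: less_Suc_eq)
  qed
qed simp

lemma sa_run_append:
  "sa_run A c (u @ v) c'' \<longleftrightarrow> (\<exists>c'. sa_run A c u c' \<and> sa_run A c' v c'')"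
proof (induction u arbitrary: c)
  case Nil
  have "sa_run A c [] c' \<longleftrightarrow> c' = c" for c'
    by (auto intro: sa_run.intros elim: sa_run.cases)
  then show ?case by simp
next
  case (Cons x u)
  have "sa_run A c (x # w) c'' \<longleftrightarrow> (\<exists>c'. sa_step A c x c' \<and> sa_run A c' w c'')" for w c''
    by (subst sa_run.simps) simp
  then show ?case by (simp only: append_Cons Cons.IH) blast
qed

lemma sa_run_snoc:
  "sa_run A c (u @ [x]) c'' \<longleftrightarrow> (\<exists>c'. sa_run A c u c' \<and> sa_step A c' x c'')"
proof -
  have "sa_run A c' [x] c'' \<longleftrightarrow> sa_step A c' x c''" for c'
    by (auto intro: sa_run.intros elim: sa_run.cases)
  then show ?thesis by (simp add: sa_run_append)
qed

lemma sa_step_iff: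
  "sa_step A (s, \<tau>, U) (a, d) (s', \<tau>', U') \<longleftrightarrow>
     (\<exists>p. (s, (a, p), s') \<in> sa_trans A \<and>
        (case p of Fresh r \<Rightarrow> d \<notin> U | Reuse r \<Rightarrow> \<tau> r = Some d) \<and>
        \<tau>' = \<tau>(op_reg p \<mapsto> d) \<and> U' = insert d U)" (is "?l \<longleftrightarrow> ?r")
proof
  assume ?l
  then show ?r
  proof cases
    case (fresh r)
    then show ?thesis by (intro exI[of _ "Fresh r"]) simp
  next
    case (reuse r)
    then show ?thesis by (intro exI[of _ "Reuse r"]) simp
  qed
next
  assume ?r
  then obtain p where p: "(s, (a, p), s') \<in> sa_trans A"
    "case p of Fresh r \<Rightarrow> d \<notin> U | Reuse r \<Rightarrow> \<tau> r = Some d"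
    "\<tau>' = \<tau>(op_reg p \<mapsto> d)" "U' = insert d U" by blast
  then show ?l
    using sa_step.fresh[of s a _ s' A d U \<tau>] sa_step.reuse[of s a _ s' A \<tau> d U]
    by (cases p) auto
qed

text \<open>A run splits into a path in the transition graph, which ignores data, and the condition
  \<open>legal\<close>, which ignores states. The induction is on the end of the word, where the
  configuration is known.\<close>

lemma sa_run_iff:
  "sa_run A (s0, Map.empty, {}) w (s, \<tau>, U) \<longleftrightarrow>
     (\<exists>\<sigma> p. \<sigma> 0 = s0 \<and> \<sigma> (length w) = s \<and>
        (\<forall>i<length w. (\<sigma> i, (fst (w ! i), p i), \<sigma> (Suc i)) \<in> sa_trans A) \<and>
        legal p (\<lambda>i. snd (w ! i)) (length w) \<and>
        \<tau> = tau p (\<lambda>i. snd (w ! i)) (length w) \<and> U = (\<lambda>i. snd (w ! i)) ` {..<length w})"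
proof (induction w arbitrary: s \<tau> U rule: rev_induct)
  case Nil
  have "sa_run A (s0, Map.empty, {}) [] (s, \<tau>, U) \<longleftrightarrow> s0 = s \<and> \<tau> = Map.empty \<and> U = {}"
    by (auto intro: sa_run.intros elim: sa_run.cases)
  then show ?case by auto
next
  case (snoc x w)
  obtain a d where x: "x = (a, d)" by (cases x)
  let ?n = "length w"
  \<comment> \<open>The data values are taken from the longer word, so that the induction hypothesis
    and the goal speak of the same sequence.\<close>
  define D where "D = (\<lambda>i. snd ((w @ [x]) ! i))"
  have D: "D i = snd (w ! i)" if "i < ?n" for i using that by (simp add: D_def nth_append)
  have Dn: "D ?n = d" by (simp add: D_def x)
  have IH: "sa_run A (s0, Map.empty, {}) w (s, \<tau>, U) \<longleftrightarrow>
     (\<exists>\<sigma> p. \<sigma> 0 = s0 \<and> \<sigma> ?n = s \<and>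
        (\<forall>i<?n. (\<sigma> i, (fst (w ! i), p i), \<sigma> (Suc i)) \<in> sa_trans A) \<and>
        legal p D ?n \<and> \<tau> = tau p D ?n \<and> U = D ` {..<?n})" for s \<tau> U
  proof -
    have "legal p D ?n \<longleftrightarrow> legal p (\<lambda>i. snd (w ! i)) ?n" for p :: "nat \<Rightarrow> 'b reg_op"
      by (rule legal_cong) (simp_all add: D)
    moreover have "tau p D ?n = tau p (\<lambda>i. snd (w ! i)) ?n" for p :: "nat \<Rightarrow> 'b reg_op"
      by (rule tau_cong) (simp_all add: D)
    moreover have "D ` {..<?n} = (\<lambda>i. snd (w ! i)) ` {..<?n}"
      by (rule image_cong) (simp_all add: D)
    ultimately show ?thesis unfolding snoc.IH by simp
  qed
  have Dimg: "D ` {..<Suc ?n} = insert d (D ` {..<?n})"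
    by (simp add: lessThan_Suc Dn)
  have "sa_run A (s0, Map.empty, {}) (w @ [x]) (s, \<tau>, U) \<longleftrightarrow>
     (\<exists>\<sigma> p. \<sigma> 0 = s0 \<and> \<sigma> (Suc ?n) = s \<and>
        (\<forall>i<Suc ?n. (\<sigma> i, (fst ((w @ [x]) ! i), p i), \<sigma> (Suc i)) \<in> sa_trans A) \<and>
        legal p D (Suc ?n) \<and> \<tau> = tau p D (Suc ?n) \<and> U = D ` {..<Suc ?n})" (is "?l \<longleftrightarrow> ?r")
  proof
    assume ?l
    then obtain s1 \<tau>1 U1 where run: "sa_run A (s0, Map.empty, {}) w (s1, \<tau>1, U1)"
      and step: "sa_step A (s1, \<tau>1, U1) (a, d) (s, \<tau>, U)"
      by (auto simp: sa_run_snoc x)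
    from run obtain \<sigma> p where sp: "\<sigma> 0 = s0" "\<sigma> ?n = s1"
      "\<And>i. i < ?n \<Longrightarrow> (\<sigma> i, (fst (w ! i), p i), \<sigma> (Suc i)) \<in> sa_trans A"
      "legal p D ?n" "\<tau>1 = tau p D ?n" "U1 = D ` {..<?n}" unfolding IH by blast
    from step obtain q where q: "(s1, (a, q), s) \<in> sa_trans A"
      "case q of Fresh r \<Rightarrow> d \<notin> U1 | Reuse r \<Rightarrow> \<tau>1 r = Some d"
      "\<tau> = \<tau>1(op_reg q \<mapsto> d)" "U = insert d U1" unfolding sa_step_iff by blast
    define \<sigma>' where "\<sigma>' = \<sigma>(Suc ?n := s)"
    define p' where "p' = p(?n := q)"
    have t: "tau p' D ?n = tau p D ?n" by (rule tau_cong) (simp_all add: p'_def)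
    have l: "legal p' D ?n" using sp(4) by (subst legal_cong[of _ p' p D D]) (simp_all add: p'_def)
    show ?r
    proof (intro exI[of _ \<sigma>'] exI[of _ p'] conjI allI impI)
      show "(\<sigma>' i, (fst ((w @ [x]) ! i), p' i), \<sigma>' (Suc i)) \<in> sa_trans A" if "i < Suc ?n" for i
        using that sp q by (auto simp: \<sigma>'_def p'_def less_Suc_eq nth_append x)
      show "legal p' D (Suc ?n)"
        using l q(2) sp t by (auto simp: enabled_def p'_def Dn split: reg_op.splits)
      show "\<tau> = tau p' D (Suc ?n)" using q(3) sp t by (simp add: p'_def Dn)
      show "U = D ` {..<Suc ?n}" using q(4) sp Dimg by simp
    qed (use sp in \<open>simp_all add: \<sigma>'_def\<close>)
  next
    assume ?r
    then obtain \<sigma> p where sp: "\<sigma> 0 = s0" "\<sigma> (Suc ?n) = s"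
      "\<And>i. i < Suc ?n \<Longrightarrow> (\<sigma> i, (fst ((w @ [x]) ! i), p i), \<sigma> (Suc i)) \<in> sa_trans A"
      "legal p D (Suc ?n)" "\<tau> = tau p D (Suc ?n)" "U = D ` {..<Suc ?n}" by blast
    have "\<And>i. i < ?n \<Longrightarrow> (\<sigma> i, (fst (w ! i), p i), \<sigma> (Suc i)) \<in> sa_trans A"
      using sp(3) by (metis less_Suc_eq nth_append)
    then have "sa_run A (s0, Map.empty, {}) w (\<sigma> ?n, tau p D ?n, D ` {..<?n})"
      unfolding IH using sp by auto
    moreover have "sa_step A (\<sigma> ?n, tau p D ?n, D ` {..<?n}) x (s, \<tau>, U)"
      unfolding x sa_step_iff using sp(2) sp(3)[of ?n] sp(4-) Dimg
      by (intro exI[of _ "p ?n"]) (auto simp: enabled_def Dn x split: reg_op.splits)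
    ultimately show ?l by (auto simp: sa_run_snoc)
  qed
  then show ?case by (simp only: D_def length_append_singleton)
qed

lemma sa_lang_iff:
  "w \<in> sa_lang A \<longleftrightarrow>
     (\<exists>\<sigma> p. \<sigma> 0 = sa_init A \<and> \<sigma> (length w) \<in> sa_final A \<and>
        (\<forall>i<length w. (\<sigma> i, (fst (w ! i), p i), \<sigma> (Suc i)) \<in> sa_trans A) \<and>
        legal p (\<lambda>i. snd (w ! i)) (length w))"
  unfolding sa_lang_def mem_Collect_eq sa_run_iff by blast

section \<open>Sessions and legality\<close>

text \<open>The left end of the interval is excluded, as a \<open>Fresh\<close> there may open the
  common session; the right end is included, as a \<open>Fresh\<close> there starts another
  one.\<close>

definition sess :: "(nat \<Rightarrow> 'r reg_op) \<Rightarrow> nat \<Rightarrow> nat \<Rightarrow> bool" where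
  "sess p i j \<longleftrightarrow> op_reg (p i) = op_reg (p j) \<and>
     (\<forall>z. min i j < z \<and> z \<le> max i j \<longrightarrow> p z \<noteq> Fresh (op_reg (p i)))"

definition fresh_started :: "(nat \<Rightarrow> 'r reg_op) \<Rightarrow> nat \<Rightarrow> bool" where
  "fresh_started p n \<longleftrightarrow> (\<forall>i<n. \<exists>z\<le>i. p z = Fresh (op_reg (p i)))"

lemma sess_refl [simp]: "sess p i i"
  by (auto simp: sess_def)

lemma sess_commute: "sess p i j \<longleftrightarrow> sess p j i"
  by (auto simp: sess_def min.commute max.commute)

lemma sess_less:
  "i < j \<Longrightarrow> sess p i j \<longleftrightarrow>
     op_reg (p i) = op_reg (p j) \<and> (\<forall>z. i < z \<and> z \<le> j \<longrightarrow> p z \<noteq> Fresh (op_reg (p j)))"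
  by (auto simp: sess_def)

text \<open>A \<open>Fresh\<close> at \<open>j\<close> brings a new value and cuts off all earlier
  positions. A \<open>Reuse\<close> at \<open>j\<close> continues the session of the last earlier
  use \<open>k\<close> of the register, where the value is the same, so the claim reduces to
  \<open>k\<close>.\<close>

lemma legal_imp_sess:
  assumes "legal p d n"
  shows "j < n \<Longrightarrow> (\<forall>i<j. d i = d j \<longleftrightarrow> sess p i j) \<and> (\<exists>z\<le>j. p z = Fresh (op_reg (p j)))"
proof (induction j rule: less_induct)
  case (less j)
  from assms less.prems have en: "enabled p d j" by (simp add: legal_def)
  show ?case
  proof (cases "p j")
    case (Fresh r)
    then have "d j \<notin> d ` {..<j}" using en by (simp add: enabled_def)
    then have "d i \<noteq> d j" if "i < j" for i using that by (metis imageI lessThan_iff)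
    moreover have "\<not> sess p i j" if "i < j" for i
      using that Fresh by (auto simp: sess_less intro: exI[of _ j])
    ultimately show ?thesis using Fresh by (auto intro: exI[of _ j])
  next
    case (Reuse r)
    then have "tau p d j r = Some (d j)" using en by (simp add: enabled_def)
    then obtain k where k: "k < j" "op_reg (p k) = r" "d k = d j"
      "\<And>z. k < z \<Longrightarrow> z < j \<Longrightarrow> op_reg (p z) \<noteq> r" unfolding tau_eq_Some by blast
    have nofresh: "p z \<noteq> Fresh r" if "k < z" "z \<le> j" for z
      using k(4)[OF that(1)] that Reuse by (cases "z = j") auto
    have IH: "\<And>i. i < k \<Longrightarrow> d i = d k \<longleftrightarrow> sess p i k" "\<exists>z\<le>k. p z = Fresh (op_reg (p k))"
      using less.IH[of k] less.prems k(1) by auto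
    have "d i = d j \<longleftrightarrow> sess p i j" if "i < j" for i
    proof -
      consider "i < k" | "i = k" | "k < i" by linarith
      then show ?thesis
      proof cases
        case 1
        then have "sess p i j \<longleftrightarrow> sess p i k"
          using that Reuse k(1,2) nofresh by (auto simp: sess_less) (metis linorder_not_le)+
        then show ?thesis using IH 1 k(3) by simp
      next
        case 2
        then have "sess p i j" using Reuse k nofresh by (auto simp: sess_less)
        then show ?thesis using 2 k(3) by simp
      next
        \<comment> \<open>A position between \<open>k\<close> and \<open>j\<close> uses another
          register; the induction hypothesis at \<open>i\<close> gives \<open>d i\<close> a value
          other than \<open>d k\<close>, which is \<open>d j\<close>.\<close>
        case 3
        then have r: "op_reg (p i) \<noteq> r" using k(4) that by blast
        have "d k = d i \<longleftrightarrow> sess p k i" using less.IH[of i] less.prems that 3 by auto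
        moreover have "\<not> sess p k i" using r k(2) by (auto simp: sess_def)
        moreover have "\<not> sess p i j" using r Reuse by (auto simp: sess_def)
        ultimately show ?thesis using k(3) by auto
      qed
    qed
    moreover have "\<exists>z\<le>j. p z = Fresh (op_reg (p j))"
      using IH(2) k(1,2) Reuse by (auto intro: less_imp_le le_trans)
    ultimately show ?thesis by blast
  qed
qed

lemma legal_iff_sess:
  "legal p d n \<longleftrightarrow>
     fresh_started p n \<and> (\<forall>i<n. \<forall>j<n. d i = d j \<longleftrightarrow> sess p i j)" (is "?l \<longleftrightarrow> ?r")
proof
  assume l: ?l
  have "d i = d j \<longleftrightarrow> sess p i j" if "i < n" "j < n" for i j
  proof -
    consider "i < j" | "i = j" | "j < i" by linarith
    then show ?thesis
      using legal_imp_sess[OF l, of i] legal_imp_sess[OF l, of j] that sess_commute[of p i j]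
      by cases auto
  qed
  then show ?r using legal_imp_sess[OF l] by (simp add: fresh_started_def)
next
  assume r: ?r
  have "enabled p d j" if j: "j < n" for j
  proof (cases "p j")
    case (Fresh r)
    have "d i \<noteq> d j" if "i < j" for i
    proof -
      have "\<not> sess p i j" using that Fresh by (auto simp: sess_less intro: exI[of _ j])
      then show ?thesis using r j that by auto
    qed
    then show ?thesis using Fresh by (force simp: enabled_def)
  next
    case (Reuse s)
    then obtain z where z: "z \<le> j" "p z = Fresh s"
      using r j by (force simp: fresh_started_def)
    \<comment> \<open>The last earlier use of the register. One exists because the initial
      \<open>Fresh\<close> at \<open>z\<close> cannot be at \<open>j\<close>, which is a
      \<open>Reuse\<close>.\<close>
    define k where "k = Max {i. i < j \<and> op_reg (p i) = s}"
    have "z < j" using z Reuse by (cases "z = j") auto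
    then have ne: "{i. i < j \<and> op_reg (p i) = s} \<noteq> {}" using z by auto
    have "k \<in> {i. i < j \<and> op_reg (p i) = s}"
      unfolding k_def using ne by (intro Max_in) auto
    then have k: "k < j" "op_reg (p k) = s" by auto
    have last: "op_reg (p i) \<noteq> s" if "k < i" "i < j" for i
    proof
      assume "op_reg (p i) = s"
      then have "i \<le> k" unfolding k_def using that by (intro Max_ge) auto
      then show False using that by simp
    qed
    have "p i \<noteq> Fresh s" if "k < i" "i \<le> j" for i
      using last[OF that(1)] that(2) Reuse by (cases "i = j") auto
    then have "sess p k j" using k Reuse by (auto simp: sess_less)
    then have "d k = d j" using r j k by auto
    then have "tau p d j s = Some (d j)" unfolding tau_eq_Some using k last by blast
    then show ?thesis using Reuse by (simp add: enabled_def)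
  qed
  then show ?l by (simp add: legal_def)
qed

section \<open>Realising data values with boundedly many registers\<close>

text \<open>Greedy allocation: a register is free for a new data value whenever at most \<open>k\<close> of the
  values seen so far are still needed.\<close>

lemma register_allocation:
  fixes d :: "nat \<Rightarrow> 'd"
  assumes "\<And>m. m < n \<Longrightarrow> card (d ` {..<m} \<inter> d ` {m..<n}) \<le> k"
  shows "\<exists>p. legal p d n \<and> (\<forall>i<n. op_reg (p i) \<le> k)"
proof -
  \<comment> \<open>Invariant: each value that occurs both before \<open>m\<close> and from
    \<open>m\<close> on is held by some register.\<close>
  have "\<exists>p. legal p d m \<and> (\<forall>i<m. op_reg (p i) \<le> k) \<and>
      (\<forall>a \<in> d ` {..<m} \<inter> d ` {m..<n}. \<exists>r\<le>k. tau p d m r = Some a)" if "m \<le> n" for m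
    using that
  proof (induction m)
    case (Suc m)
    let ?O = "\<lambda>m. d ` {..<m} \<inter> d ` {m..<n}"
    from Suc obtain p where p: "legal p d m" "\<And>i. i < m \<Longrightarrow> op_reg (p i) \<le> k"
      "\<And>a. a \<in> ?O m \<Longrightarrow> \<exists>r\<le>k. tau p d m r = Some a" by auto
    have tau_upd: "tau (p(m := q)) d m = tau p d m" for q
      by (rule tau_cong) simp_all
    have legal_upd: "legal (p(m := q)) d m" for q
      using p(1) by (subst legal_cong[of _ _ p d d]) simp_all
    have sub: "{Suc m..<n} \<subseteq> {m..<n}" by auto
    have mn: "m \<in> {m..<n}" using Suc.prems by auto
    show ?case
    proof (cases "d m \<in> d ` {..<m}")
      case True
      then obtain r where r: "r \<le> k" "tau p d m r = Some (d m)"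
        using p(3)[of "d m"] mn by blast
      let ?p = "p(m := Reuse r)"
      have "tau ?p d (Suc m) = tau p d m" using r(2) by (auto simp: tau_upd)
      moreover have "\<forall>a \<in> ?O (Suc m). \<exists>r\<le>k. tau p d m r = Some a"
      proof
        fix a assume "a \<in> ?O (Suc m)"
        then have "a \<in> ?O m" using True sub by (auto simp: lessThan_Suc)
        then show "\<exists>r\<le>k. tau p d m r = Some a" by (rule p(3))
      qed
      moreover have "legal ?p d (Suc m)"
        using legal_upd r(2) by (simp add: enabled_def tau_upd)
      moreover have "\<forall>i<Suc m. op_reg (?p i) \<le> k" using p(2) r(1) by (auto simp: less_Suc_eq)
      ultimately show ?thesis by (intro exI[of _ ?p]) (simp only: simp_thms)
    next
      case False
      \<comment> \<open>\<open>g\<close> names a register for each value still needed. At most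
        \<open>k\<close> of the \<open>k + 1\<close> registers are named, so another one can be
        overwritten without loss.\<close>
      from p(3) obtain g where g: "\<And>a. a \<in> ?O m \<Longrightarrow> g a \<le> k \<and> tau p d m (g a) = Some a"
        by metis
      have "card (g ` ?O m) \<le> k"
        using assms[of m] Suc.prems card_image_le[of "?O m" g] by simp
      then have "card (g ` ?O m) < card {..k}" by simp
      then have "\<not> {..k} \<subseteq> g ` ?O m"
        by (meson card_mono finite_Int finite_imageI finite_lessThan not_le)
      then obtain r where r: "r \<le> k" "r \<notin> g ` ?O m" by auto
      let ?p = "p(m := Fresh r)"
      have t: "tau ?p d (Suc m) = (tau p d m)(r \<mapsto> d m)" by (simp add: tau_upd)
      have "\<exists>r\<le>k. tau ?p d (Suc m) r = Some a" if a: "a \<in> ?O (Suc m)" for a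
      proof (cases "a = d m")
        case True
        then show ?thesis using r(1) unfolding t by auto
      next
        case False
        then have "a \<in> ?O m" using a sub by (auto simp: lessThan_Suc)
        then show ?thesis using g r(2) unfolding t by (intro exI[of _ "g a"]) auto
      qed
      moreover have "legal ?p d (Suc m)" using legal_upd False by (simp add: enabled_def)
      moreover have "\<forall>i<Suc m. op_reg (?p i) \<le> k" using p(2) r(1) by (auto simp: less_Suc_eq)
      ultimately show ?thesis by blast
    qed
  qed simp
  from this[of n] show ?thesis by blast
qed

section \<open>From session automata to sMSO\<close>

definition Falsum :: "'a dmso" where
  "Falsum = Ex1 0 (Neg (Eq 0 0))"

definition Disj :: "'a dmso list \<Rightarrow> 'a dmso" where
  "Disj \<phi>s = foldr Or \<phi>s Falsum"

definition Conj :: "'a dmso list \<Rightarrow> 'a dmso" where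
  "Conj \<phi>s = Neg (Disj (map Neg \<phi>s))"

lemma Falsum_simps [simp]:
  "\<not> sat w v V Falsum" "fv1 Falsum = {}" "fv2 Falsum = {}" "classical_mso Falsum"
  by (auto simp: Falsum_def)

lemma Disj_simps [simp]:
  "sat w v V (Disj \<phi>s) \<longleftrightarrow> (\<exists>\<phi>\<in>set \<phi>s. sat w v V \<phi>)"
  "fv1 (Disj \<phi>s) = \<Union> (fv1 ` set \<phi>s)"
  "fv2 (Disj \<phi>s) = \<Union> (fv2 ` set \<phi>s)"
  "classical_mso (Disj \<phi>s) \<longleftrightarrow> (\<forall>\<phi>\<in>set \<phi>s. classical_mso \<phi>)"
  unfolding Disj_def by (induction \<phi>s) auto

lemma Conj_simps [simp]:
  "sat w v V (Conj \<phi>s) \<longleftrightarrow> (\<forall>\<phi>\<in>set \<phi>s. sat w v V \<phi>)"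
  "fv1 (Conj \<phi>s) = \<Union> (fv1 ` set \<phi>s)"
  "fv2 (Conj \<phi>s) = \<Union> (fv2 ` set \<phi>s)"
  "classical_mso (Conj \<phi>s) \<longleftrightarrow> (\<forall>\<phi>\<in>set \<phi>s. classical_mso \<phi>)"
  unfolding Conj_def by auto

text \<open>Order is definable from successor: no set closed under successor contains
  \<open>x\<close> and misses \<open>y\<close>. The bound names \<open>x + y + 1\<close> and
  \<open>x + y + 2\<close> differ from \<open>x\<close>, \<open>y\<close> and each other.\<close>

definition Le :: "nat \<Rightarrow> nat \<Rightarrow> 'a dmso" where
  "Le x y = Neg (Ex2 0 (And (Mem x 0) (And (Neg (Mem y 0))
     (All1 (x + y + 1) (All1 (x + y + 2)
       (Or (Neg (Succ (x + y + 1) (x + y + 2)))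
         (Or (Neg (Mem (x + y + 1) 0)) (Mem (x + y + 2) 0))))))))"

lemma Le_fv [simp]: "fv1 (Le x y) = {x, y}" "fv2 (Le x y) = {}" "classical_mso (Le x y)"
  by (auto simp: Le_def)

lemma sat_Le:
  assumes "v x < length w" "v y < length w"
  shows "sat w v V (Le x y) \<longleftrightarrow> v x \<le> v y"
proof -
  have "sat w v V (Le x y) \<longleftrightarrow>
      \<not> (\<exists>P\<subseteq>{..<length w}. v x \<in> P \<and> v y \<notin> P \<and> (\<forall>i. Suc i < length w \<longrightarrow> i \<in> P \<longrightarrow> Suc i \<in> P))"
    by (auto simp: Le_def)
  also have "\<dots> \<longleftrightarrow> v x \<le> v y"
  proof
    assume no: "\<not> (\<exists>P\<subseteq>{..<length w}. v x \<in> P \<and> v y \<notin> P \<and>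
      (\<forall>i. Suc i < length w \<longrightarrow> i \<in> P \<longrightarrow> Suc i \<in> P))"
    show "v x \<le> v y"
    proof (rule ccontr)
      assume "\<not> v x \<le> v y"
      \<comment> \<open>The suffix starting at \<open>v x\<close> separates the two
        positions.\<close>
      then show False using no assms by (auto dest!: spec[of _ "{v x..<length w}"])
    qed
  next
    assume le: "v x \<le> v y"
    show "\<not> (\<exists>P\<subseteq>{..<length w}. v x \<in> P \<and> v y \<notin> P \<and>
      (\<forall>i. Suc i < length w \<longrightarrow> i \<in> P \<longrightarrow> Suc i \<in> P))"
    proof clarify
      fix P assume P: "v x \<in> P" "v y \<notin> P" "\<forall>i. Suc i < length w \<longrightarrow> i \<in> P \<longrightarrow> Suc i \<in> P"
      have "j < length w \<longrightarrow> j \<in> P" if "v x \<le> j" for j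
        using that by (induction rule: dec_induct) (use P in auto)
      then show False using le assms P by blast
    qed
  qed
  finally show ?thesis .
qed

text \<open>A colouring of the positions with \<open>m\<close> colours is represented by the second-order variables
  \<open>N, \<dots>, N + m - 1\<close>; \<open>opc\<close> tells which register operation a colour stands for.\<close>

definition is_col :: "(nat \<Rightarrow> nat set) \<Rightarrow> nat \<Rightarrow> nat \<Rightarrow> nat \<Rightarrow> (nat \<Rightarrow> nat) \<Rightarrow> bool" where
  "is_col V N m n col \<longleftrightarrow> (\<forall>i<n. col i < m \<and> (\<forall>c<m. i \<in> V (N + c) \<longleftrightarrow> c = col i))"

lemma is_colD:
  "is_col V N m n col \<Longrightarrow> i < n \<Longrightarrow> col i < m"
  "is_col V N m n col \<Longrightarrow> i < n \<Longrightarrow> c < m \<Longrightarrow> i \<in> V (N + c) \<longleftrightarrow> c = col i"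
  by (auto simp: is_col_def)

definition Has_colour :: "nat \<Rightarrow> nat \<Rightarrow> (nat \<Rightarrow> bool) \<Rightarrow> nat \<Rightarrow> 'a dmso" where
  "Has_colour N m P x = Disj (map (\<lambda>c. Mem x (N + c)) (filter P [0..<m]))"

lemma sat_Has_colour:
  "is_col V N m (length w) col \<Longrightarrow> v x < length w \<Longrightarrow>
     sat w v V (Has_colour N m P x) \<longleftrightarrow> P (col (v x))"
  by (auto simp: Has_colour_def is_col_def)

definition Coloring :: "nat \<Rightarrow> nat \<Rightarrow> 'a dmso" where
  "Coloring N m = All1 0 (Disj (map (\<lambda>c. And (Mem 0 (N + c))
     (Conj (map (\<lambda>c'. Neg (Mem 0 (N + c'))) (filter (\<lambda>c'. c' \<noteq> c) [0..<m])))) [0..<m]))"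

lemma Coloring_fv [simp]:
  "fv1 (Coloring N m) = {}" "fv2 (Coloring N m) \<subseteq> {N..<N + m}" "classical_mso (Coloring N m)"
  by (auto simp: Coloring_def)

lemma sat_Coloring:
  "sat w v V (Coloring N m) \<longleftrightarrow> (\<exists>col. is_col V N m (length w) col)"
proof -
  have "sat w v V (Coloring N m) \<longleftrightarrow>
      (\<forall>i<length w. \<exists>c<m. i \<in> V (N + c) \<and> (\<forall>c'<m. c' \<noteq> c \<longrightarrow> i \<notin> V (N + c')))"
    by (force simp: Coloring_def)
  also have "\<dots> \<longleftrightarrow> (\<forall>i<length w. \<exists>c<m. \<forall>c'<m. i \<in> V (N + c') \<longleftrightarrow> c' = c)"
    by metis
  also have "\<dots> \<longleftrightarrow> (\<exists>col. is_col V N m (length w) col)"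
    unfolding is_col_def by (rule choice_iff')
  finally show ?thesis .
qed

text \<open>The outer disjunction fixes the colour of \<open>x\<close>, and with it the register
  named in the inner formulas. The two disjuncts under \<open>Ex1\<close> cover both orders of
  \<open>x\<close> and \<open>y\<close>.\<close>

definition Same_session :: "nat \<Rightarrow> nat \<Rightarrow> (nat \<Rightarrow> 'r reg_op) \<Rightarrow> nat \<Rightarrow> nat \<Rightarrow> 'a dmso" where
  "Same_session N m opc x y = Disj (map (\<lambda>c. And (Mem x (N + c))
     (And (Has_colour N m (\<lambda>c'. op_reg (opc c') = op_reg (opc c)) y)
       (Neg (Ex1 (x + y + 1) (And
         (Has_colour N m (\<lambda>c'. opc c' = Fresh (op_reg (opc c))) (x + y + 1))
         (Or (And (Neg (Le (x + y + 1) x)) (Le (x + y + 1) y))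
           (And (Neg (Le (x + y + 1) y)) (Le (x + y + 1) x)))))))) [0..<m])"

lemma Same_session_fv:
  "fv1 (Same_session N m opc x y) \<subseteq> {x, y}"
  "fv2 (Same_session N m opc x y) \<subseteq> {N..<N + m}"
  "classical_mso (Same_session N m opc x y)"
  by (auto simp: Same_session_def Has_colour_def split: if_splits)

lemma sat_Same_session:
  assumes col: "is_col V N m (length w) col" and x: "v x < length w" and y: "v y < length w"
  shows "sat w v V (Same_session N m opc x y) \<longleftrightarrow> sess (\<lambda>i. opc (col i)) (v x) (v y)"
proof -
  let ?r = "op_reg (opc (col (v x)))"
  define z where "z = x + y + 1"
  have z: "z \<noteq> x" "z \<noteq> y" by (auto simp: z_def)
  have "sat w v V (Same_session N m opc x y) \<longleftrightarrow> op_reg (opc (col (v y))) = ?r \<and>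
      \<not> (\<exists>i<length w. opc (col i) = Fresh ?r \<and> (v x < i \<and> i \<le> v y \<or> v y < i \<and> i \<le> v x))"
    unfolding Same_session_def z_def[symmetric] using is_colD[OF col] x y z
    by (auto simp: sat_Has_colour[OF col] sat_Le not_le cong: conj_cong)
  also have "\<dots> \<longleftrightarrow> sess (\<lambda>i. opc (col i)) (v x) (v y)"
    using x y by (auto simp: sess_def min_def max_def split: if_splits)
  finally show ?thesis .
qed

definition Fresh_started :: "nat \<Rightarrow> nat \<Rightarrow> (nat \<Rightarrow> 'r reg_op) \<Rightarrow> 'a dmso" where
  "Fresh_started N m opc = All1 0 (Disj (map (\<lambda>c. And (Mem 0 (N + c))
     (Ex1 1 (And (Le 1 0) (Has_colour N m (\<lambda>c'. opc c' = Fresh (op_reg (opc c))) 1)))) [0..<m]))"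

lemma Fresh_started_fv:
  "fv1 (Fresh_started N m opc) = {}"
  "fv2 (Fresh_started N m opc) \<subseteq> {N..<N + m}"
  "classical_mso (Fresh_started N m opc)"
  by (auto simp: Fresh_started_def Has_colour_def)

lemma sat_Fresh_started:
  assumes col: "is_col V N m (length w) col"
  shows "sat w v V (Fresh_started N m opc) \<longleftrightarrow> fresh_started (\<lambda>i. opc (col i)) (length w)"
proof -
  have "sat w v V (Fresh_started N m opc) \<longleftrightarrow>
      (\<forall>i<length w. \<exists>j<length w. j \<le> i \<and> opc (col j) = Fresh (op_reg (opc (col i))))"
    using is_colD[OF col]
    by (auto simp: Fresh_started_def sat_Has_colour[OF col] sat_Le cong: conj_cong)
  also have "\<dots> \<longleftrightarrow> fresh_started (\<lambda>i. opc (col i)) (length w)"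
    unfolding fresh_started_def by (meson le_less_trans)
  finally show ?thesis .
qed

abbreviation src :: "'s \<times> ('a \<times> 'p) \<times> 's \<Rightarrow> 's" where "src t \<equiv> fst t"
abbreviation lab :: "'s \<times> ('a \<times> 'p) \<times> 's \<Rightarrow> 'a" where "lab t \<equiv> fst (fst (snd t))"
abbreviation opn :: "'s \<times> ('a \<times> 'p) \<times> 's \<Rightarrow> 'p" where "opn t \<equiv> snd (fst (snd t))"
abbreviation tgt :: "'s \<times> ('a \<times> 'p) \<times> 's \<Rightarrow> 's" where "tgt t \<equiv> snd (snd t)"

text \<open>States are not guessed but read off from the guessed transitions. The conjuncts treat
  labels, neighbouring transitions, the position without predecessor and the one without successor;
  the empty word has no transition and needs the last conjunct.\<close>

definition Accepting_path ::
  "('s \<times> ('a \<times> 'p) \<times> 's) list \<Rightarrow> 's \<Rightarrow> 's set \<Rightarrow> 'a dmso" where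
  "Accepting_path ts s0 F = (let m = length ts in
     And (All1 0 (Disj (map (\<lambda>c. And (Mem 0 (0 + c)) (Label 0 (lab (ts ! c)))) [0..<m])))
    (And (All1 0 (All1 1 (Or (Neg (Succ 0 1)) (Disj (map (\<lambda>c. And (Mem 0 (0 + c))
           (Has_colour 0 m (\<lambda>c'. src (ts ! c') = tgt (ts ! c)) 1)) [0..<m])))))
    (And (All1 0 (Or (Ex1 1 (Succ 1 0)) (Has_colour 0 m (\<lambda>c. src (ts ! c) = s0) 0)))
    (And (All1 0 (Or (Ex1 1 (Succ 0 1)) (Has_colour 0 m (\<lambda>c. tgt (ts ! c) \<in> F) 0)))
      (if s0 \<in> F then Neg Falsum else Ex1 0 (Eq 0 0))))))"

lemma Accepting_path_fv:
  "fv1 (Accepting_path ts s0 F) = {}"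
  "fv2 (Accepting_path ts s0 F) \<subseteq> {0..<length ts}"
  "classical_mso (Accepting_path ts s0 F)"
  by (auto simp: Accepting_path_def Let_def Has_colour_def)

lemma sat_Accepting_path:
  fixes ts :: "('s \<times> ('a \<times> 'p) \<times> 's) list"
  assumes col: "is_col V 0 (length ts) (length w) col"
  shows "sat w v V (Accepting_path ts s0 F) \<longleftrightarrow>
    (\<exists>\<sigma>. \<sigma> 0 = s0 \<and> \<sigma> (length w) \<in> F \<and>
      (\<forall>i<length w. ts ! col i = (\<sigma> i, (fst (w ! i), opn (ts ! col i)), \<sigma> (Suc i))))"
    (is "_ \<longleftrightarrow> (\<exists>\<sigma>. ?path \<sigma>)")
proof -
  let ?n = "length w"
  have lab: "sat w v V (All1 0 (Disj (map (\<lambda>c. And (Mem 0 (0 + c)) (Label 0 (lab (ts ! c))))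
      [0..<length ts]))) \<longleftrightarrow> (\<forall>i<?n. lab (ts ! col i) = fst (w ! i))"
    using is_colD[OF col] by auto
  have step: "sat w v V (All1 0 (All1 1 (Or (Neg (Succ 0 1)) (Disj (map (\<lambda>c. And (Mem 0 (0 + c))
           (Has_colour 0 (length ts) (\<lambda>c'. src (ts ! c') = tgt (ts ! c)) 1)) [0..<length ts]))))) \<longleftrightarrow>
      (\<forall>i. Suc i < ?n \<longrightarrow> src (ts ! col (Suc i)) = tgt (ts ! col i))"
    using is_colD[OF col] by (auto simp: sat_Has_colour[OF col])
  have first: "sat w v V (All1 0 (Or (Ex1 1 (Succ 1 0))
      (Has_colour 0 (length ts) (\<lambda>c. src (ts ! c) = s0) 0))) \<longleftrightarrow> (0 < ?n \<longrightarrow> src (ts ! col 0) = s0)"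
    (is "?L \<longleftrightarrow> ?R")
  proof -
    have "?L \<longleftrightarrow> (\<forall>i<?n. (\<exists>j<?n. i = Suc j) \<or> src (ts ! col i) = s0)"
      by (simp add: sat_Has_colour[OF col])
    also have "\<dots> \<longleftrightarrow> ?R" by (metis Suc_lessD gr0_conv_Suc nat.distinct(1) neq0_conv)
    finally show ?thesis .
  qed
  have last: "sat w v V (All1 0 (Or (Ex1 1 (Succ 0 1))
      (Has_colour 0 (length ts) (\<lambda>c. tgt (ts ! c) \<in> F) 0))) \<longleftrightarrow>
      (\<forall>i. Suc i = ?n \<longrightarrow> tgt (ts ! col i) \<in> F)"
    (is "?L \<longleftrightarrow> ?R")
  proof -
    have "?L \<longleftrightarrow> (\<forall>i<?n. Suc i < ?n \<or> tgt (ts ! col i) \<in> F)"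
      by (simp add: sat_Has_colour[OF col])
    also have "\<dots> \<longleftrightarrow> ?R" by (metis Suc_lessI lessI less_irrefl)
    finally show ?thesis .
  qed
  have empty: "sat w v V (if s0 \<in> F then Neg Falsum else Ex1 0 (Eq 0 0)) \<longleftrightarrow> (?n = 0 \<longrightarrow> s0 \<in> F)"
    by auto
  have "sat w v V (Accepting_path ts s0 F) \<longleftrightarrow>
      (\<forall>i<?n. lab (ts ! col i) = fst (w ! i)) \<and>
      (\<forall>i. Suc i < ?n \<longrightarrow> src (ts ! col (Suc i)) = tgt (ts ! col i)) \<and>
      (0 < ?n \<longrightarrow> src (ts ! col 0) = s0) \<and> (\<forall>i. Suc i = ?n \<longrightarrow> tgt (ts ! col i) \<in> F) \<and>
      (?n = 0 \<longrightarrow> s0 \<in> F)" (is "_ \<longleftrightarrow> ?conds")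
    unfolding Accepting_path_def Let_def sat_And lab step first last empty ..
  also have "\<dots> \<longleftrightarrow> (\<exists>\<sigma>. ?path \<sigma>)"
  proof
    assume c: ?conds
    \<comment> \<open>The state reached after \<open>j + 1\<close> letters is the target of
      transition \<open>j\<close>; \<open>s0\<close> is the state before the first letter.\<close>
    define \<sigma> where "\<sigma> i = (case i of 0 \<Rightarrow> s0 | Suc j \<Rightarrow> tgt (ts ! col j))" for i
    have "src (ts ! col i) = \<sigma> i" if "i < ?n" for i
      using c that by (cases i) (auto simp: \<sigma>_def)
    moreover have "\<sigma> ?n \<in> F" using c by (cases ?n) (auto simp: \<sigma>_def)
    moreover have "\<sigma> 0 = s0" "\<And>i. \<sigma> (Suc i) = tgt (ts ! col i)"
      by (simp_all add: \<sigma>_def)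
    ultimately have "?path \<sigma>" using c by (simp add: prod_eq_iff)
    then show "\<exists>\<sigma>. ?path \<sigma>" by blast
  next
    assume "\<exists>\<sigma>. ?path \<sigma>"
    then obtain \<sigma> where s: "?path \<sigma>" by blast
    then have st: "src (ts ! col i) = \<sigma> i" "lab (ts ! col i) = fst (w ! i)"
      "tgt (ts ! col i) = \<sigma> (Suc i)" if "i < ?n" for i
      using that by (metis fst_conv snd_conv)+
    show ?conds
    proof (intro conjI allI impI)
      show "tgt (ts ! col i) \<in> F" if "Suc i = ?n" for i
        using st(3)[of i] that s by simp
    qed (use s st in auto)
  qed
  finally show ?thesis .
qed

text \<open>The colours are indices of transitions, so one colour fixes label, states and operation.
  By \<open>legal_iff_sess\<close>, legality is the fresh start required by \<open>\<alpha>\<close>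
  together with the equivalence of \<open>Sim\<close> and the session relation
  \<open>\<beta>\<close>.\<close>

lemma smso_sentence_if_session_automaton:
  fixes A :: "('s, 'r, 'a) session_automaton"
  assumes "session_automaton A"
  shows "\<exists>\<phi> :: 'a dmso. smso_sentence \<phi> \<and> dmso_lang \<phi> = (sa_lang A :: ('a, 'd) data_word set)"
proof -
  have "finite (sa_trans A)" using assms by (simp add: session_automaton_def)
  then obtain ts where ts: "set ts = sa_trans A" using finite_list by blast
  define m where "m = length ts"
  define opc where "opc c = opn (ts ! c)" for c
  define \<alpha> where "\<alpha> = And (Coloring 0 m)
    (And (Fresh_started 0 m opc) (Accepting_path ts (sa_init A) (sa_final A)))"
  define \<beta> :: "'a dmso" where "\<beta> = Same_session 0 m opc 0 1"
  define \<psi> where "\<psi> = And \<alpha> (All1 0 (All1 1 (Iff (Sim 0 1) \<beta>)))"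
  define \<phi> where "\<phi> = foldr Ex2 [0..<m] \<psi>"
  have "fv1 \<alpha> = {}" "fv2 \<alpha> \<subseteq> {0..<m}" "classical_mso \<alpha>"
    using Coloring_fv[of 0 m] Fresh_started_fv[of 0 m opc] Accepting_path_fv[of ts]
    by (auto simp: \<alpha>_def m_def)
  moreover have "fv1 \<beta> \<subseteq> {0, 1}" "fv2 \<beta> \<subseteq> {0..<m}" "classical_mso \<beta>"
    using Same_session_fv[of 0 m opc 0 1] by (auto simp: \<beta>_def)
  ultimately have "sentence \<phi>" "classical_mso \<alpha>" "classical_mso \<beta>"
    by (auto simp: sentence_def \<phi>_def \<psi>_def fv_foldr_Ex2)
  then have smso: "smso_sentence \<phi>"
    unfolding smso_sentence_def \<phi>_def \<psi>_def by (metis zero_neq_one)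
  have sat_\<psi>: "sat w v V \<psi> \<longleftrightarrow>
      (\<exists>\<sigma>. \<sigma> 0 = sa_init A \<and> \<sigma> (length w) \<in> sa_final A \<and>
        (\<forall>i<length w. ts ! col i = (\<sigma> i, (fst (w ! i), opc (col i)), \<sigma> (Suc i)))) \<and>
      legal (\<lambda>i. opc (col i)) (\<lambda>i. snd (w ! i)) (length w)"
    if col: "is_col V 0 m (length w) col" for w :: "('a, 'd) data_word" and v V col
  proof -
    have C: "sat w v V (Coloring 0 m)" using col sat_Coloring by blast
    have "sat w (v(0 := i, 1 := j)) V \<beta> \<longleftrightarrow> sess (\<lambda>i. opc (col i)) i j"
      if "i < length w" "j < length w" for i j
      unfolding \<beta>_def using that by (subst sat_Same_session[OF col]) auto
    then have D: "sat w v V (All1 0 (All1 1 (Iff (Sim 0 1) \<beta>))) \<longleftrightarrow>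
        (\<forall>i<length w. \<forall>j<length w. snd (w ! i) = snd (w ! j) \<longleftrightarrow> sess (\<lambda>i. opc (col i)) i j)"
      by simp
    show ?thesis
      unfolding \<psi>_def \<alpha>_def sat_And D sat_Fresh_started[OF col] legal_iff_sess
        sat_Accepting_path[OF col[unfolded m_def]] opc_def
      using C by blast
  qed
  have "w \<in> dmso_lang \<phi> \<longleftrightarrow> w \<in> sa_lang A" for w :: "('a, 'd) data_word"
  proof
    assume "w \<in> dmso_lang \<phi>"
    then obtain V where V: "sat w (\<lambda>_. 0) V \<psi>"
      by (auto simp: dmso_lang_def \<phi>_def sat_foldr_Ex2)
    then obtain col where col: "is_col V 0 m (length w) col"
      by (auto simp: \<psi>_def \<alpha>_def sat_Coloring)
    from V[unfolded sat_\<psi>[OF col]] obtain \<sigma> where s: "\<sigma> 0 = sa_init A" "\<sigma> (length w) \<in> sa_final A"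
      "\<forall>i<length w. ts ! col i = (\<sigma> i, (fst (w ! i), opc (col i)), \<sigma> (Suc i))"
      "legal (\<lambda>i. opc (col i)) (\<lambda>i. snd (w ! i)) (length w)" by blast
    moreover have "ts ! col i \<in> sa_trans A" if "i < length w" for i
      using is_colD(1)[OF col that] ts nth_mem by (auto simp: m_def)
    ultimately show "w \<in> sa_lang A" unfolding sa_lang_iff
      by (intro exI[of _ \<sigma>] exI[of _ "\<lambda>i. opc (col i)"]) metis
  next
    assume "w \<in> sa_lang A"
    then obtain \<sigma> p where s: "\<sigma> 0 = sa_init A" "\<sigma> (length w) \<in> sa_final A"
      "\<And>i. i < length w \<Longrightarrow> (\<sigma> i, (fst (w ! i), p i), \<sigma> (Suc i)) \<in> set ts"
      "legal p (\<lambda>i. snd (w ! i)) (length w)" unfolding sa_lang_iff ts by blast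
    then obtain col where c: "\<And>i. i < length w \<Longrightarrow> col i < m \<and>
        ts ! col i = (\<sigma> i, (fst (w ! i), p i), \<sigma> (Suc i))"
      unfolding in_set_conv_nth m_def by metis
    \<comment> \<open>Colour classes as sets; variables from \<open>m\<close> on get the empty set,
      as under the valuation fixed by \<open>dmso_lang\<close>.\<close>
    define V where "V X = {i. i < length w \<and> col i = X}" for X
    have col: "is_col V 0 m (length w) col" using c by (auto simp: is_col_def V_def)
    have "legal (\<lambda>i. opc (col i)) (\<lambda>i. snd (w ! i)) (length w)"
      using s(4) c by (subst legal_cong[of _ _ p]) (auto simp: opc_def)
    moreover have "\<forall>i<length w. ts ! col i = (\<sigma> i, (fst (w ! i), opc (col i)), \<sigma> (Suc i))"
      using c by (auto simp: opc_def)
    ultimately have "sat w (\<lambda>_. 0) V \<psi>" unfolding sat_\<psi>[OF col] using s by blast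
    moreover have "V X \<subseteq> {..<length w}" "X \<notin> set [0..<m] \<Longrightarrow> V X = {}" for X
      using c by (auto simp: V_def)
    ultimately show "w \<in> dmso_lang \<phi>"
      unfolding dmso_lang_def \<phi>_def mem_Collect_eq sat_foldr_Ex2 by blast
  qed
  then show ?thesis using smso by blast
qed

section \<open>From sMSO to session automata\<close>

text \<open>The residuals of \<open>P\<close> are the states; reading a letter consumes its label and performs one of
  the register operations it offers.\<close>

lemma residual_automaton:
  fixes P :: "'b list \<Rightarrow> bool" and lb :: "'b \<Rightarrow> 'a::finite" and ops :: "'b \<Rightarrow> 'r reg_op set"
  assumes reg: "regular P" and regs: "finite Rs" "Rs \<noteq> {}" "\<And>l p. p \<in> ops l \<Longrightarrow> op_reg p \<in> Rs"
  shows "\<exists>A :: (nat, 'r, 'a) session_automaton. session_automaton A \<and>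
    (\<forall>w :: ('a, 'd) data_word. w \<in> sa_lang A \<longleftrightarrow>
      (\<exists>e p. length e = length w \<and> P e \<and>
        (\<forall>i<length w. lb (e ! i) = fst (w ! i) \<and> p i \<in> ops (e ! i)) \<and>
        legal p (\<lambda>i. snd (w ! i)) (length w)))"
proof -
  let ?R = "residual P"
  have fin: "finite (range ?R)" using reg by (simp add: regular_def)
  \<comment> \<open>Residuals are sets of words; \<open>f\<close> numbers them, since states are
    natural numbers.\<close>
  then obtain f :: "'b list set \<Rightarrow> nat" where f: "inj_on f (range ?R)"
    using finite_imp_inj_to_nat_seg by blast
  define T where "T = {(f (?R u), (lb l, p), f (?R (u @ [l]))) | u l p. p \<in> ops l}"
  define A where "A = \<lparr>sa_states = f ` range ?R, sa_regs = Rs, sa_init = f (?R []),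
    sa_final = {f (?R u) | u. P u}, sa_trans = T\<rparr>"
  \<comment> \<open>Finiteness comes from the residuals, the labels and the registers; the letter
    type may be infinite.\<close>
  have "T \<subseteq> f ` range ?R \<times> (UNIV \<times> (Fresh ` Rs \<union> Reuse ` Rs)) \<times> f ` range ?R"
  proof
    fix t assume "t \<in> T"
    then obtain u l p where t: "t = (f (?R u), (lb l, p), f (?R (u @ [l])))" "p \<in> ops l"
      unfolding T_def by blast
    from regs(3)[OF t(2)] have "p \<in> Fresh ` Rs \<union> Reuse ` Rs" by (cases p) auto
    then show "t \<in> f ` range ?R \<times> (UNIV \<times> (Fresh ` Rs \<union> Reuse ` Rs)) \<times> f ` range ?R"
      using t(1) by blast
  qed
  then have "finite T" by (rule finite_subset) (use fin regs in auto)
  moreover have "\<forall>(s, (a, p), s') \<in> T. s \<in> f ` range ?R \<and> op_reg p \<in> Rs \<and> s' \<in> f ` range ?R"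
    using regs(3) by (auto simp: T_def)
  ultimately have "session_automaton A"
    using fin regs(1,2) by (auto simp: session_automaton_def A_def)
  moreover have "w \<in> sa_lang A \<longleftrightarrow>
      (\<exists>e p. length e = length w \<and> P e \<and>
        (\<forall>i<length w. lb (e ! i) = fst (w ! i) \<and> p i \<in> ops (e ! i)) \<and>
        legal p (\<lambda>i. snd (w ! i)) (length w))" for w :: "('a, 'd) data_word"
  proof
    assume "w \<in> sa_lang A"
    then obtain \<sigma> p where s: "\<sigma> 0 = f (?R [])" "\<sigma> (length w) \<in> {f (?R u) | u. P u}"
      "\<And>i. i < length w \<Longrightarrow> (\<sigma> i, (fst (w ! i), p i), \<sigma> (Suc i)) \<in> T"
      "legal p (\<lambda>i. snd (w ! i)) (length w)" unfolding sa_lang_iff by (auto simp: A_def)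
    have "\<exists>l. (\<exists>u. \<sigma> i = f (?R u) \<and> \<sigma> (Suc i) = f (?R (u @ [l]))) \<and> lb l = fst (w ! i) \<and> p i \<in> ops l"
      if "i < length w" for i
      using s(3)[OF that] unfolding T_def by auto
    then obtain l where l: "\<And>i. i < length w \<Longrightarrow>
        (\<exists>u. \<sigma> i = f (?R u) \<and> \<sigma> (Suc i) = f (?R (u @ [l i]))) \<and> lb (l i) = fst (w ! i) \<and> p i \<in> ops (l i)"
      by metis
    \<comment> \<open>The representatives \<open>u\<close> of consecutive transitions need not
      match. Equal residuals suffice, because they stay equal after appending the same
      letter.\<close>
    have \<sigma>: "i \<le> length w \<Longrightarrow> \<sigma> i = f (?R (map l [0..<i]))" for i
    proof (induction i)
      case (Suc i)
      then obtain u where u: "\<sigma> i = f (?R u)" "\<sigma> (Suc i) = f (?R (u @ [l i]))"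
        using l[of i] by auto
      have "?R u = ?R (map l [0..<i])"
        using Suc u(1) by (intro inj_onD[OF f]) auto
      then have "?R (u @ [l i]) = ?R (map l [0..<i] @ [l i])"
        by (auto simp: residual_def set_eq_iff)
      then show ?case using u(2) by simp
    qed (simp add: s(1))
    define e where "e = map l [0..<length w]"
    from s(2) obtain u where u: "f (?R e) = f (?R u)" "P u" using \<sigma>[of "length w"] e_def by auto
    then have "?R e = ?R u" by (intro inj_onD[OF f]) auto
    \<comment> \<open>Acceptance is visible in the residual: \<open>P u\<close> means that it
      contains the empty word.\<close>
    moreover have "[] \<in> ?R u" using u(2) by (simp add: residual_def)
    ultimately have "P e" by (metis append_Nil2 mem_Collect_eq residual_def)
    then show "\<exists>e p. length e = length w \<and> P e \<and>
        (\<forall>i<length w. lb (e ! i) = fst (w ! i) \<and> p i \<in> ops (e ! i)) \<and>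
        legal p (\<lambda>i. snd (w ! i)) (length w)"
      using l s(4) by (intro exI[of _ e] exI[of _ p]) (simp add: e_def)
  next
    assume "\<exists>e p. length e = length w \<and> P e \<and>
        (\<forall>i<length w. lb (e ! i) = fst (w ! i) \<and> p i \<in> ops (e ! i)) \<and>
        legal p (\<lambda>i. snd (w ! i)) (length w)"
    then obtain e p where e: "length e = length w" "P e"
      "\<And>i. i < length w \<Longrightarrow> lb (e ! i) = fst (w ! i) \<and> p i \<in> ops (e ! i)"
      "legal p (\<lambda>i. snd (w ! i)) (length w)" by blast
    have "(f (?R (take i e)), (fst (w ! i), p i), f (?R (take (Suc i) e))) \<in> T"
      if "i < length w" for i
    proof -
      have "take (Suc i) e = take i e @ [e ! i]"
        using that e(1) by (simp add: take_Suc_conv_app_nth)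
      then show ?thesis unfolding T_def using e(3)[OF that] by force
    qed
    then show "w \<in> sa_lang A"
      unfolding sa_lang_iff using e
      by (intro exI[of _ "\<lambda>i. f (?R (take i e))"] exI[of _ p]) (auto simp: A_def)
  qed
  ultimately show ?thesis by (intro exI[of _ A] conjI allI)
qed

text \<open>If two positions before the cut \<open>m\<close> lead to the same residual of \<open>\<beta>\<close>, then \<open>\<beta>\<close> cannot
  tell them apart from behind the cut; so at most one data value per residual crosses it.\<close>

lemma card_crossing_values_le:
  fixes w :: "('a, 'd) data_word"
  defines "d \<equiv> (\<lambda>i. snd (w ! i))"
  assumes cl: "classical_mso \<beta>" and fv: "fv1 \<beta> \<subseteq> {x, y}" and xy: "x \<noteq> y"
    and eq: "\<And>i j. i < length w \<Longrightarrow> j < length w \<Longrightarrow>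
      d i = d j \<longleftrightarrow> sat w ((\<lambda>_. length w)(x := i, y := j)) V \<beta>"
    and m: "m < length w"
  shows "card (d ` {..<m} \<inter> d ` {m..<length w}) \<le> card (range (residual (\<lambda>e. wsat e \<beta>)))"
proof -
  let ?n = "length w" and ?R = "residual (\<lambda>e. wsat e \<beta>)"
  define E where "E i j = enc w ((\<lambda>_. ?n)(x := i, y := j)) V" for i j
  have len [simp]: "length (E i j) = ?n" for i j by (simp add: E_def)
  have split: "E i j = take m (E i ?n) @ drop m (E ?n j)" if "i < m" "m \<le> j" "j < ?n" for i j
    \<comment> \<open>Position \<open>?n\<close> is outside the word, so the prefix carries only the
      mark of \<open>x\<close> and the suffix only that of \<open>y\<close>.\<close>
    using that m xy by (intro nth_equalityI) (auto simp: nth_append E_def)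
  have wsat_E: "wsat (E i j) \<beta> \<longleftrightarrow> d i = d j" if "i < ?n" "j < ?n" for i j
    unfolding E_def eq[OF that] using that fv by (intro wsat_enc[OF cl]) auto
  have res: "drop m (E ?n j) \<in> ?R (take m (E i ?n)) \<longleftrightarrow> d i = d j"
    if "i < m" "m \<le> j" "j < ?n" for i j
    using split[OF that] wsat_E[of i j] that m by (simp add: residual_def)
  let ?O = "d ` {..<m} \<inter> d ` {m..<?n}"
  have "\<forall>a\<in>?O. \<exists>i. i < m \<and> d i = a" "\<forall>a\<in>?O. \<exists>j. m \<le> j \<and> j < ?n \<and> d j = a" by auto
  then obtain g h where g: "\<And>a. a \<in> ?O \<Longrightarrow> g a < m \<and> d (g a) = a"
    and h: "\<And>a. a \<in> ?O \<Longrightarrow> m \<le> h a \<and> h a < ?n \<and> d (h a) = a" by metis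
  \<comment> \<open>Each crossing value is sent to the residual reached with \<open>x\<close> at an
    occurrence before the cut; an occurrence behind the cut tells different values apart.\<close>
  have "inj_on (\<lambda>a. ?R (take m (E (g a) ?n))) ?O"
  proof (rule inj_onI)
    fix a b assume a: "a \<in> ?O" and b: "b \<in> ?O"
      and R: "?R (take m (E (g a) ?n)) = ?R (take m (E (g b) ?n))"
    have "drop m (E ?n (h a)) \<in> ?R (take m (E (g a) ?n))"
      using res[of "g a" "h a"] g[OF a] h[OF a] by simp
    then have "d (g b) = d (h a)"
      unfolding R using res[of "g b" "h a"] g[OF b] h[OF a] by simp
    then show "a = b" using g[OF b] h[OF a] by simp
  qed
  moreover have "finite (range ?R)" using regular_wsat by (auto simp: regular_def)
  ultimately show ?thesis by (intro card_inj_on_le) auto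
qed

section \<open>Guessing register operations for an sMSO sentence\<close>

text \<open>Parity distinguishes the two kinds of operation, so the colours below
  \<open>2 * k + 2\<close> are exactly the operations on registers \<open>0\<close> to
  \<open>k\<close>.\<close>

definition colour_op :: "nat \<Rightarrow> nat reg_op" where
  "colour_op c = (if even c then Fresh (c div 2) else Reuse (c div 2))"

primrec op_colour :: "nat reg_op \<Rightarrow> nat" where
  "op_colour (Fresh r) = 2 * r"
| "op_colour (Reuse r) = 2 * r + 1"

lemma colour_op_op_colour [simp]: "colour_op (op_colour p) = p"
  by (cases p) (simp_all add: colour_op_def)

lemma op_colour_less: "op_reg p \<le> k \<Longrightarrow> op_colour p < 2 * k + 2"
  by (cases p) simp_all

lemma op_reg_colour_op: "c < 2 * k + 2 \<Longrightarrow> op_reg (colour_op c) \<le> k"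
  by (auto simp: colour_op_def)

text \<open>The formula \<open>\<gamma>\<close> adds a guessed colouring by register operations to
  \<open>\<alpha>\<close> and replaces \<open>Sim\<close> by the session relation. It is classical,
  so \<open>residual_automaton\<close> applies, and legality of the run restores the link with the
  data.\<close>

lemma session_automaton_if_smso_sentence:
  fixes \<phi> :: "'a::finite dmso"
  assumes "smso_sentence \<phi>"
  shows "\<exists>A :: (nat, nat, 'a) session_automaton.
    session_automaton A \<and> sa_lang A = (dmso_lang \<phi> :: ('a, 'd) data_word set)"
proof -
  from assms obtain Xs \<alpha> x y \<beta> where xy: "x \<noteq> y" and cl: "classical_mso \<alpha>" "classical_mso \<beta>"
    and \<phi>: "\<phi> = foldr Ex2 Xs (And \<alpha> (All1 x (All1 y (Iff (Sim x y) \<beta>))))" and sen: "sentence \<phi>"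
    unfolding smso_sentence_def by blast
  from sen have fv: "fv1 \<alpha> = {}" "fv1 \<beta> \<subseteq> {x, y}" "fv2 \<alpha> \<subseteq> set Xs" "fv2 \<beta> \<subseteq> set Xs"
    by (auto simp: sentence_def \<phi> fv_foldr_Ex2)
  have lang: "w \<in> dmso_lang \<phi> \<longleftrightarrow>
      (\<exists>V. (\<forall>X\<in>set Xs. V X \<subseteq> {..<length w}) \<and> (\<forall>X. X \<notin> set Xs \<longrightarrow> V X = {}) \<and>
        sat w (\<lambda>_. length w) V \<alpha> \<and> (\<forall>i<length w. \<forall>j<length w. snd (w ! i) = snd (w ! j) \<longleftrightarrow>
          sat w ((\<lambda>_. length w)(x := i, y := j)) V \<beta>))" for w :: "('a, 'd) data_word"
  proof -
    have "sat w (\<lambda>_. 0) V \<alpha> \<longleftrightarrow> sat w (\<lambda>_. length w) V \<alpha>" for V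
      using fv by (intro sat_cong) auto
    moreover have "sat w ((\<lambda>_. 0)(x := i, y := j)) V \<beta> \<longleftrightarrow>
        sat w ((\<lambda>_. length w)(x := i, y := j)) V \<beta>" for V i j
      using fv by (intro sat_cong) auto
    ultimately show ?thesis using xy by (simp add: dmso_lang_def \<phi> sat_foldr_Ex2)
  qed
  \<comment> \<open>The set variables from \<open>N\<close> on are disjoint from \<open>Xs\<close>
    and are used for the colours.\<close>
  obtain N where N: "\<And>X. X \<in> set Xs \<Longrightarrow> X < N"
    using finite_nat_set_iff_bounded[of "set Xs"] by auto
  define k where "k = card (range (residual (\<lambda>e. wsat e \<beta>)))"
  define m where "m = 2 * k + 2"
  define \<delta> :: "'a dmso"
    where "\<delta> = All1 x (All1 y (Iff (Same_session N m colour_op x y) \<beta>))"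
  define \<gamma> where "\<gamma> = And \<alpha> (And (Coloring N m) (And (Fresh_started N m colour_op) \<delta>))"
  have \<gamma>: "fv1 \<gamma> = {}" "classical_mso \<gamma>"
    using fv cl Coloring_fv[of N m] Fresh_started_fv[of N m colour_op]
      Same_session_fv[of N m colour_op x y] by (auto simp: \<gamma>_def \<delta>_def)
  have sat_\<gamma>: "sat w v V \<gamma> \<longleftrightarrow> sat w v V \<alpha> \<and> fresh_started (\<lambda>i. colour_op (col i)) (length w) \<and>
      (\<forall>i<length w. \<forall>j<length w.
        sess (\<lambda>i. colour_op (col i)) i j \<longleftrightarrow> sat w (v(x := i, y := j)) V \<beta>)"
    if col: "is_col V N m (length w) col" for w :: "('a, 'd) data_word" and v V col
  proof -
    have C: "sat w v V (Coloring N m)" using col sat_Coloring by blast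
    have "sat w (v(x := i, y := j)) V (Same_session N m colour_op x y) \<longleftrightarrow>
        sess (\<lambda>i. colour_op (col i)) i j" if "i < length w" "j < length w" for i j
      using that xy by (subst sat_Same_session[OF col]) auto
    then have "sat w v V \<delta> \<longleftrightarrow> (\<forall>i<length w. \<forall>j<length w.
        sess (\<lambda>i. colour_op (col i)) i j \<longleftrightarrow> sat w (v(x := i, y := j)) V \<beta>)"
      unfolding \<delta>_def by simp
    then show ?thesis
      unfolding \<gamma>_def sat_And sat_Fresh_started[OF col] using C by blast
  qed
  \<comment> \<open>\<open>\<gamma>\<close> has no free first-order variables, so their tracks are
    left empty. A letter offers the operations whose colour variables it contains;
    \<open>Coloring\<close> makes this a single one.\<close>
  define P where "P e = wsat (map (\<lambda>(a, Z). (a, {}, Z)) e) \<gamma>" for e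
  define ops where "ops = (\<lambda>(a :: 'a, Z). {colour_op c | c. c < m \<and> N + c \<in> Z})"
  have "regular P"
    unfolding P_def by (rule regular_map) (rule regular_wsat)
  moreover have "op_reg p \<in> {..k}" if "p \<in> ops l" for p l
    using that op_reg_colour_op by (auto simp: ops_def m_def split: prod.splits)
  ultimately obtain A :: "(nat, nat, 'a) session_automaton" where A: "session_automaton A"
    and A_lang: "\<And>w :: ('a, 'd) data_word. w \<in> sa_lang A \<longleftrightarrow>
      (\<exists>e p. length e = length w \<and> P e \<and>
        (\<forall>i<length w. fst (e ! i) = fst (w ! i) \<and> p i \<in> ops (e ! i)) \<and>
        legal p (\<lambda>i. snd (w ! i)) (length w))"
    using residual_automaton[of P "{..k}" ops fst, where 'd = 'd] by auto
  have P_enc: "P e \<longleftrightarrow> sat w (\<lambda>_. length w) V \<gamma>"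
    if "length e = length w" "\<And>i. i < length w \<Longrightarrow> e ! i = (fst (w ! i), {X. i \<in> V X})"
    for e and w :: "('a, 'd) data_word" and V
  proof -
    have "map (\<lambda>(a, Z). (a, {}, Z)) e = enc w (\<lambda>_. length w) V"
      using that by (intro nth_equalityI) auto
    then show ?thesis unfolding P_def using wsat_enc[OF \<gamma>(2), of "\<lambda>_. length w"] \<gamma>(1) by simp
  qed
  have "w \<in> sa_lang A \<longleftrightarrow> w \<in> dmso_lang \<phi>" for w :: "('a, 'd) data_word"
  proof
    assume "w \<in> sa_lang A"
    then obtain e p where e: "length e = length w" "P e"
      "\<And>i. i < length w \<Longrightarrow> fst (e ! i) = fst (w ! i) \<and> p i \<in> ops (e ! i)"
      "legal p (\<lambda>i. snd (w ! i)) (length w)" unfolding A_lang by blast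
    define V where "V X = {i. i < length w \<and> X \<in> snd (e ! i)}" for X
    have "e ! i = (fst (w ! i), {X. i \<in> V X})" if "i < length w" for i
      using e(3)[OF that] that by (simp add: V_def prod_eq_iff)
    then have sat: "sat w (\<lambda>_. length w) V \<gamma>" using P_enc[OF e(1)] e(2) by blast
    then obtain col where col: "is_col V N m (length w) col"
      by (auto simp: \<gamma>_def sat_Coloring)
    have p: "p i = colour_op (col i)" if i: "i < length w" for i
    proof -
      from e(3)[OF i] obtain c where "c < m" "N + c \<in> snd (e ! i)" "p i = colour_op c"
        by (auto simp: ops_def split: prod.splits)
      then show ?thesis using is_colD(2)[OF col i, of c] i by (simp add: V_def)
    qed
    have "legal (\<lambda>i. colour_op (col i)) (\<lambda>i. snd (w ! i)) (length w)"
      using e(4) p by (subst legal_cong[of _ _ p]) auto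
    then have \<beta>: "snd (w ! i) = snd (w ! j) \<longleftrightarrow> sat w ((\<lambda>_. length w)(x := i, y := j)) V \<beta>"
      if "i < length w" "j < length w" for i j
      using sat that unfolding sat_\<gamma>[OF col] legal_iff_sess by blast
    have \<alpha>: "sat w (\<lambda>_. length w) V \<alpha>" using sat by (simp add: \<gamma>_def)
    \<comment> \<open>The colour sets are dropped, as \<open>lang\<close> requires empty sets
      outside \<open>Xs\<close>; neither \<open>\<alpha>\<close> nor \<open>\<beta>\<close> mentions
      them.\<close>
    define V' where "V' X = (if X \<in> set Xs then V X else {})" for X
    have "sat w v V' \<alpha> \<longleftrightarrow> sat w v V \<alpha>" "sat w v V' \<beta> \<longleftrightarrow> sat w v V \<beta>" for v
      using fv by (auto simp: V'_def intro!: sat_cong)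
    then have "sat w (\<lambda>_. length w) V' \<alpha>" "\<forall>i<length w. \<forall>j<length w. snd (w ! i) = snd (w ! j) \<longleftrightarrow>
        sat w ((\<lambda>_. length w)(x := i, y := j)) V' \<beta>"
      using \<alpha> \<beta> by simp_all
    moreover have "\<forall>X\<in>set Xs. V' X \<subseteq> {..<length w}" "\<forall>X. X \<notin> set Xs \<longrightarrow> V' X = {}"
      by (auto simp: V'_def V_def)
    ultimately show "w \<in> dmso_lang \<phi>" unfolding lang by blast
  next
    assume "w \<in> dmso_lang \<phi>"
    then obtain V where \<alpha>: "sat w (\<lambda>_. length w) V \<alpha>"
      and \<beta>: "\<And>i j. i < length w \<Longrightarrow> j < length w \<Longrightarrow> snd (w ! i) = snd (w ! j) \<longleftrightarrow>
          sat w ((\<lambda>_. length w)(x := i, y := j)) V \<beta>" unfolding lang by blast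
    obtain p where p: "legal p (\<lambda>i. snd (w ! i)) (length w)" "\<And>i. i < length w \<Longrightarrow> op_reg (p i) \<le> k"
      using register_allocation[OF card_crossing_values_le[OF cl(2) fv(2) xy \<beta>]]
      unfolding k_def by blast
    define col where "col i = op_colour (p i)" for i
    have col_less: "col i < m" if "i < length w" for i
      using op_colour_less[OF p(2)[OF that]] by (simp add: col_def m_def)
    \<comment> \<open>Conversely, the colour classes of the allocated operations are added outside
      \<open>Xs\<close>.\<close>
    define V' where "V' X = (if X \<in> set Xs then V X else {i. i < length w \<and> X = N + col i})" for X
    have notin: "N + c \<notin> set Xs" for c using N[of "N + c"] by auto
    have col: "is_col V' N m (length w) col"
      using col_less by (auto simp: is_col_def V'_def notin)
    have op: "colour_op (col i) = p i" for i by (simp add: col_def)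
    have "sat w v V' \<alpha> \<longleftrightarrow> sat w v V \<alpha>" "sat w v V' \<beta> \<longleftrightarrow> sat w v V \<beta>" for v
      using fv by (auto simp: V'_def intro!: sat_cong)
    then have "sat w (\<lambda>_. length w) V' \<gamma>"
      unfolding sat_\<gamma>[OF col] op using \<alpha> \<beta> p(1)[unfolded legal_iff_sess] by simp
    moreover define e where "e = map (\<lambda>i. (fst (w ! i), {X. i \<in> V' X})) [0..<length w]"
    ultimately have "P e" by (subst P_enc) (simp_all add: e_def)
    moreover have "p i \<in> ops (e ! i)" if "i < length w" for i
      using that col_less[OF that] op[of i]
      by (auto simp: ops_def e_def V'_def notin intro!: exI[of _ "col i"])
    ultimately show "w \<in> sa_lang A" unfolding A_lang using p(1)
      by (intro exI[of _ e] exI[of _ p]) (simp add: e_def)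
  qed
  then show ?thesis using A by blast
qed

theorem theorem4p5:
  fixes L :: "('a::finite, 'd) data_word set"
  assumes "infinite (UNIV :: 'd set)"
    and "data_language L"
  shows "(\<exists>A :: (nat, nat, 'a) session_automaton. session_automaton A \<and> sa_lang A = L) \<longleftrightarrow>
         (\<exists>\<phi> :: 'a dmso. smso_sentence \<phi> \<and> dmso_lang \<phi> = L)"
  using smso_sentence_if_session_automaton session_automaton_if_smso_sentence by blast

end
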